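(* Let $0<r_0<r_1$, $\tau>0$, $\mathcal{J}>0$, let $n\in\{2,3\}$, and let $B(r)=r^{n-1}\tilde b(r)$ with $\tilde b\in L^\infty(r_0,r_1)$, $\tilde b>0$. Consider the boundary value problem $$\left[r^{n-1}\left(\frac{1}{m}-\frac{\mathcal{J}^2}{m^3}\right)m_r+\frac{r^{n-1}\mathcal{J}}{\tau m}\right]_r=m-B(r)+r^{n-3}(n-1)(n-2)\ \text{ on } (r_0,r_1),\qquad m(r_0)=m(r_1)=\mathcal{J}. \quad (\ast)$$ 1. Case $n=2$. Put $\underline{B}=\operatorname{ess\,inf}_{[r_0,r_1]}B$. If $\underline{B}+\frac1\tau>\mathcal{J}$, then $(\ast)$ has at least one interior supersonic solution $m\in C^{1/2}[r_0,r_1]$, and it satisfies $\ell\le m(r)<\mathcal{J}$ for all $r\in(r_0,r_1)$, for some constant $\ell>0$. 2. Case $n=3$. Put $\underline{\mathcal{B}}=\operatorname{ess\,inf}_{r\in[r_0,r_1]}\left\{B(r)+\frac{2r}{\tau}-2\right\}$. If $\underline{\mathcal{B}}>\mathcal{J}$, then $(\ast)$ has an interior supersonic solution $m\in C^{1/2}[r_0,r_1]$, and it satisfies $\bar\ell\le m(r)<\mathcal{J}$ for all $r\in(r_0,r_1)$, for some constant $\bar\ell>0$.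
   Context: The subscript $r$ denotes the derivative with respect to $r$. An interior supersonic solution of $(\ast)$ is a function $m:[r_0,r_1]\to\mathbb{R}$ such that $m(r_0)=m(r_1)=\mathcal{J}$, $0<m(r)<\mathcal{J}$ for all $r\in(r_0,r_1)$, $(m-\mathcal{J})^2\in H_0^1(r_0,r_1)$, and for every $\varphi\in H_0^1(r_0,r_1)$, $$\int_{r_0}^{r_1}\left[r^{n-1}\frac{m+\mathcal{J}}{2m^3}\big((m-\mathcal{J})^2\big)_r+\frac{r^{n-1}\mathcal{J}}{\tau m}\right]\varphi_r\,dr+\int_{r_0}^{r_1}\big(m-B(r)+r^{n-3}(n-1)(n-2)\big)\varphi\,dr=0.$$ (This is the weak form of $(\ast)$, since formally $\left(\frac1m-\frac{\mathcal{J}^2}{m^3}\right)m_r=\frac{m+\mathcal{J}}{2m^3}((m-\mathcal{J})^2)_r$.) Here $m=r^{n-1}\tilde\rho$, where $\tilde\rho$ is the radial density of a steady isothermal Euler–Poisson flow in the annulus $r_0<|x|<r_1$ in $\mathbb{R}^n$ with doping profile $\tilde b$, relaxation time $\tau$, and sonic boundary data. *)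

theory Defs
  imports "HOL-Analysis.Analysis" "HOL-Probability.Essential_Supremum"
begin

text \<open>
  Functions on an interval are total functions \<^typ>\<open>real \<Rightarrow> real\<close>; every notion below depends only on
  their values on the interval in question.  Elements of Lebesgue and Sobolev spaces are represented
  by functions (not by equivalence classes), so membership is invariant under changes on null sets.
\<close>

definition L2 :: "real set \<Rightarrow> (real \<Rightarrow> real) set" where
  "L2 S = {f. f \<in> borel_measurable (lebesgue_on S) \<and> integrable (lebesgue_on S) (\<lambda>x. (f x)\<^sup>2)}"

definition Linf :: "real set \<Rightarrow> (real \<Rightarrow> real) set" where
  "Linf S = {f. f \<in> borel_measurable (lebesgue_on S) \<and>
                esssup (lebesgue_on S) (\<lambda>x. ereal \<bar>f x\<bar>) < \<infinity>}"

definition ess_inf :: "real set \<Rightarrow> (real \<Rightarrow> real) \<Rightarrow> ereal" where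
  "ess_inf S f = - esssup (lebesgue_on S) (\<lambda>x. - ereal (f x))"

definition locally_integrable :: "real set \<Rightarrow> (real \<Rightarrow> real) \<Rightarrow> bool" where
  "locally_integrable S f \<longleftrightarrow> (\<forall>K. compact K \<and> K \<subseteq> S \<longrightarrow> integrable (lebesgue_on K) f)"

text \<open>The space \<open>C\<^sub>c\<^sup>\<infinity>(a,b)\<close>, each function extended by zero to the whole line.\<close>

definition test_functions :: "real \<Rightarrow> real \<Rightarrow> (real \<Rightarrow> real) set" where
  "test_functions a b = {f. (\<forall>k x. (deriv ^^ k) f field_differentiable at x) \<and>
                            closure {x. f x \<noteq> 0} \<subseteq> {a<..<b}}"

definition has_weak_deriv :: "real \<Rightarrow> real \<Rightarrow> (real \<Rightarrow> real) \<Rightarrow> (real \<Rightarrow> real) \<Rightarrow> bool" where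
  "has_weak_deriv a b u g \<longleftrightarrow>
     locally_integrable {a<..<b} u \<and> locally_integrable {a<..<b} g \<and>
     (\<forall>\<phi>\<in>test_functions a b.
        (LINT x|lebesgue_on {a<..<b}. u x * deriv \<phi> x) =
        - (LINT x|lebesgue_on {a<..<b}. g x * \<phi> x))"

text \<open>
  Weak derivatives are unique only almost everywhere; the choice of representative is immaterial,
  since \<open>weak_deriv\<close> is used only under integrals over \<open>(a,b)\<close>.
\<close>

definition weak_deriv :: "real \<Rightarrow> real \<Rightarrow> (real \<Rightarrow> real) \<Rightarrow> real \<Rightarrow> real" where
  "weak_deriv a b u = (SOME g. has_weak_deriv a b u g)"

definition H1 :: "real \<Rightarrow> real \<Rightarrow> (real \<Rightarrow> real) set" where
  "H1 a b = {u \<in> L2 {a<..<b}. \<exists>g\<in>L2 {a<..<b}. has_weak_deriv a b u g}"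

definition H1_norm :: "real \<Rightarrow> real \<Rightarrow> (real \<Rightarrow> real) \<Rightarrow> real" where
  "H1_norm a b u = sqrt ((LINT x|lebesgue_on {a<..<b}. (u x)\<^sup>2) +
                         (LINT x|lebesgue_on {a<..<b}. (weak_deriv a b u x)\<^sup>2))"

text \<open>The closure of the test functions in the Sobolev norm.\<close>

definition H10 :: "real \<Rightarrow> real \<Rightarrow> (real \<Rightarrow> real) set" where
  "H10 a b = {u \<in> H1 a b. \<forall>\<epsilon>>0. \<exists>\<phi>\<in>test_functions a b. H1_norm a b (\<lambda>x. u x - \<phi> x) < \<epsilon>}"

definition holder_on :: "real \<Rightarrow> real set \<Rightarrow> (real \<Rightarrow> real) \<Rightarrow> bool" where
  "holder_on \<alpha> S f \<longleftrightarrow> (\<exists>C\<ge>0. \<forall>x\<in>S. \<forall>y\<in>S. \<bar>f x - f y\<bar> \<le> C * \<bar>x - y\<bar> powr \<alpha>)"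

text \<open>
  The weak formulation requires explicitly that both of its integrals exist, because the
  Bochner integral of a non-integrable function is \<open>0\<close> by convention.  The exponent \<open>n - 3\<close> may be
  negative, hence the integer power.
\<close>

definition interior_supersonic_solution ::
  "nat \<Rightarrow> real \<Rightarrow> real \<Rightarrow> real \<Rightarrow> real \<Rightarrow> (real \<Rightarrow> real) \<Rightarrow> (real \<Rightarrow> real) \<Rightarrow> bool" where
  "interior_supersonic_solution n r0 r1 \<tau> J B m \<longleftrightarrow>
     m r0 = J \<and> m r1 = J \<and>
     (\<forall>r\<in>{r0<..<r1}. 0 < m r \<and> m r < J) \<and>
     (\<lambda>r. (m r - J)\<^sup>2) \<in> H10 r0 r1 \<and>
     (\<forall>\<phi>\<in>H10 r0 r1.
        let flux = (\<lambda>r. (r ^ (n - 1) * ((m r + J) / (2 * (m r) ^ 3))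
                           * weak_deriv r0 r1 (\<lambda>s. (m s - J)\<^sup>2) r
                         + r ^ (n - 1) * J / (\<tau> * m r)) * weak_deriv r0 r1 \<phi> r);
            source = (\<lambda>r. (m r - B r + r powi (int n - 3) * (real n - 1) * (real n - 2)) * \<phi> r)
        in integrable (lebesgue_on {r0<..<r1}) flux \<and>
           integrable (lebesgue_on {r0<..<r1}) source \<and>
           (LINT r|lebesgue_on {r0<..<r1}. flux r) + (LINT r|lebesgue_on {r0<..<r1}. source r) = 0)"

end

theory Submission
  imports Defs "HOL-Computational_Algebra.Polynomial" "HOL-Real_Asymp.Real_Asymp"
    "HOL-Complex_Analysis.Great_Picard"
begin

text \<open>
  On \<open>(0, J]\<close> the enthalpy \<open>w = ln (m / J) + J\<^sup>2 / (2 m\<^sup>2) - 1 / 2\<close> is a decreasing function of \<open>m\<close> vanishing at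
  \<open>m = J\<close>, and \<open>w \<sim> (m - J)\<^sup>2 / J\<^sup>2\<close> there.  With \<open>m = G w\<close> and \<open>p r = r\<^sup>n\<^sup>-\<^sup>1\<close> the equation, integrated once, becomes
  \<open>p w' + p J / (\<tau> G w) = k + \<integral> (G w - d)\<close> with \<open>w = 0\<close> at both ends, where \<open>d\<close> collects \<open>B\<close> and the geometric
  source.  Truncating \<open>G\<close> to a continuous function with values in \<open>[l, J]\<close> makes the right-hand side bounded.
  Replacing \<open>w\<close> on the right by a delayed copy makes the initial value problem explicitly solvable and
  continuous in \<open>k\<close>, so the intermediate value theorem yields a \<open>k\<close> with \<open>w r\<^sub>1 = 0\<close>; the delay is removed by
  Arzela-Ascoli.  The condition on the essential infimum says that \<open>w = 0\<close> is a strict subsolution, which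
  forces \<open>w > 0\<close> in the interior.  Then \<open>w' r\<^sub>1 \<le> 0\<close> bounds \<open>k\<close>, hence \<open>w\<close>, independently of \<open>l\<close>, so the truncation
  is inactive for small \<open>l\<close>.  Since \<open>w\<close> is \<open>C\<^sup>1\<close>, so is \<open>(m - J)\<^sup>2\<close>, and \<open>m\<close> is Hoelder continuous of exponent \<open>1/2\<close>.
\<close>

subsection \<open>Smooth bump functions\<close>

text \<open>Near \<open>m = J\<close> the enthalpy is quadratic in \<open>m - J\<close>, so its
  inverse \<open>G\<close> has a square-root singularity at \<open>w = 0\<close>, exactly the
  prescribed boundary value. The right-hand side is therefore continuous but not Lipschitz in
  \<open>w\<close>: an initial value need not determine a solution, and the map from
  \<open>k\<close> to the terminal value of \<open>w\<close> need not be well defined. This is the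
  obstacle that the delay circumvents. The subsolution condition is found by inserting
  \<open>w = 0\<close>: the flux becomes \<open>p / \<tau>\<close>, whose derivative is
  \<open>1 / \<tau>\<close> for \<open>n = 2\<close> and \<open>2 * r / \<tau>\<close> for
  \<open>n = 3\<close>, and this has to exceed the right-hand side \<open>J - d\<close>. The
  truncation level \<open>l\<close> must be fixed before any solution is available, so the a priori
  bound has to be free of \<open>l\<close>. It is: at the right endpoint \<open>G 0 = J\<close> for
  every \<open>l\<close>, and the term with \<open>1 / G\<close>, the only one that grows as
  \<open>l\<close> decreases, enters \<open>w'\<close> with a favourable sign. The derivative of
  \<open>m\<close> may blow up at the endpoints, whereas in that of \<open>(m - J)\<^sup>2\<close>
  the vanishing factor cancels; hence the regularity is stated for the square.\<close>

definition flat :: "real poly \<Rightarrow> real \<Rightarrow> real" where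
  "flat P x = (if x > 0 then poly P (1 / x) * exp (- (1 / x)) else 0)"

text \<open>The functions \<open>P(1/x) * exp(-1/x)\<close> are closed under differentiation, which
  is why \<open>flat\<close> carries a polynomial. The factor \<open>[:0, 0, 1:]\<close> is the
  \<open>1/x^2\<close> from the chain rule, and \<open>P - pderiv P\<close> collects the two terms
  of the product rule.\<close>

definition flat_pderiv :: "real poly \<Rightarrow> real poly" where
  "flat_pderiv P = [:0, 0, 1:] * (P - pderiv P)"

lemma poly_times_exp_neg_tendsto_0:
  fixes P :: "real poly"
  shows "((\<lambda>x. poly P x * exp (- x)) \<longlongrightarrow> 0) at_top"
proof -
  have "((\<lambda>x. \<Sum>i\<le>degree P. coeff P i * (x ^ i / exp x)) \<longlongrightarrow> (\<Sum>i\<le>degree P. coeff P i * 0)) at_top"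
    by (intro tendsto_intros tendsto_power_div_exp_0)
  then show ?thesis
    by (simp add: poly_altdef exp_minus field_simps sum_distrib_right sum_divide_distrib)
qed

lemma flat_tendsto_0: "(flat P \<longlongrightarrow> 0) (at_right 0)"
proof -
  have "((\<lambda>x. poly P (1/x) * exp (- (1/x))) \<longlongrightarrow> 0) (at_right 0)"
    using filterlim_compose[OF poly_times_exp_neg_tendsto_0 filterlim_inverse_at_top_right]
    by (simp add: inverse_eq_divide)
  then show ?thesis
    by (rule Lim_transform_eventually) (auto simp: flat_def eventually_at_right_less intro: eventually_mono[OF eventually_at_right_less])
qed

lemma flat_has_real_derivative: "(flat P has_real_derivative flat (flat_pderiv P) x) (at x)"
proof -
  consider "x > 0" | "x < 0" | "x = 0" by linarith
  then show ?thesis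
  proof cases
    case 1
    have "((\<lambda>x. poly P (1/x) * exp (- (1/x))) has_real_derivative flat (flat_pderiv P) x) (at x)"
      using 1 by (auto intro!: derivative_eq_intros poly_DERIV
          simp: flat_def flat_pderiv_def field_simps power2_eq_square)
    then show ?thesis
      by (rule has_field_derivative_transform_within_open[where S="{0<..}"]) (use 1 in \<open>auto simp: flat_def\<close>)
  next
    case 2
    have "((\<lambda>x. 0) has_real_derivative 0) (at x)" by simp
    then have "(flat P has_real_derivative 0) (at x)"
      by (rule has_field_derivative_transform_within_open[where S="{..<0}"]) (use 2 in \<open>auto simp: flat_def\<close>)
    with 2 show ?thesis by (simp add: flat_def)
  next
    case 3
    have "((\<lambda>h. (flat P (0+h) - flat P 0) / h) \<longlongrightarrow> 0) (at 0)"
    proof (rule filterlim_split_at)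
      have "((\<lambda>h. 0) \<longlongrightarrow> (0::real)) (at_left 0)" by simp
      then show "((\<lambda>h. (flat P (0+h) - flat P 0) / h) \<longlongrightarrow> 0) (at_left 0)"
        by (rule Lim_transform_eventually)
           (rule eventually_at_leftI[of "-1"], auto simp: flat_def)
      show "((\<lambda>h. (flat P (0+h) - flat P 0) / h) \<longlongrightarrow> 0) (at_right 0)"
        \<comment> \<open>Dividing by \<open>h\<close> multiplies \<open>P\<close> by the monomial
          in \<open>1/h\<close>, so the difference quotient at 0 stays within the family.\<close>
        using flat_tendsto_0[of "[:0,1:] * P"]
        by (rule Lim_transform_eventually)
           (rule eventually_at_rightI[of 0 1], auto simp: flat_def)
    qed
    then have "(flat P has_real_derivative 0) (at 0)" by (simp add: DERIV_def)
    with 3 show ?thesis by (simp add: flat_def)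
  qed
qed

section \<open>Closure properties of smooth functions\<close>

definition smooth :: "(real \<Rightarrow> real) \<Rightarrow> bool" where
  "smooth f \<longleftrightarrow> (\<forall>k x. (deriv ^^ k) f field_differentiable at x)"

text \<open>Coinduction for smoothness: instead of computing iterated derivatives it is enough to
  name a class that contains a derivative of each of its members.\<close>

lemma smoothI_class:
  assumes "f \<in> S" and "\<And>g. g \<in> S \<Longrightarrow> \<exists>g'\<in>S. \<forall>x. (g has_real_derivative g' x) (at x)"
  shows "smooth f"
proof -
  have "(deriv ^^ k) f \<in> S" for k
  proof (induction k)
    case (Suc k)
    then obtain g' where g': "g' \<in> S" "\<And>x. ((deriv ^^ k) f has_real_derivative g' x) (at x)"
      using assms(2) by blast
    then have "deriv ((deriv ^^ k) f) = g'" by (auto intro: DERIV_imp_deriv)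
    then show ?case using g' by simp
  qed (use assms in auto)
  then show ?thesis
    unfolding smooth_def field_differentiable_def using assms(2) by blast
qed

lemma smooth_deriv: "smooth f \<Longrightarrow> smooth (deriv f)"
  unfolding smooth_def by (metis funpow_Suc_right o_apply)

lemma smooth_has_real_derivative: "smooth f \<Longrightarrow> (f has_real_derivative deriv f x) (at x)"
  unfolding smooth_def by (metis DERIV_deriv_iff_field_differentiable funpow_0)

lemma smooth_antiderivative:
  assumes "smooth g" "\<And>x. (f has_real_derivative g x) (at x)"
  shows "smooth f"
  by (rule smoothI_class[where S="insert f {g. smooth g}"])
     (use assms smooth_deriv smooth_has_real_derivative in blast)+

text \<open>Products of two smooth functions are not visibly closed under differentiation, because
  the product rule yields sums of products. The algebra generated by the smooth functions
  is.\<close>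

inductive_set smooth_alg :: "(real \<Rightarrow> real) set" where
  base: "smooth f \<Longrightarrow> f \<in> smooth_alg"
| add: "f \<in> smooth_alg \<Longrightarrow> g \<in> smooth_alg \<Longrightarrow> (\<lambda>x. f x + g x) \<in> smooth_alg"
| mult: "f \<in> smooth_alg \<Longrightarrow> g \<in> smooth_alg \<Longrightarrow> (\<lambda>x. f x * g x) \<in> smooth_alg"

lemma smooth_alg_imp_smooth: "f \<in> smooth_alg \<Longrightarrow> smooth f"
proof (rule smoothI_class[where S=smooth_alg])
  fix g assume "g \<in> smooth_alg"
  then show "\<exists>g'\<in>smooth_alg. \<forall>x. (g has_real_derivative g' x) (at x)"
  proof induction
    case (base f)
    then show ?case using smooth_deriv smooth_has_real_derivative smooth_alg.base by blast
  next
    case (add f g)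
    then obtain f' g' where "f' \<in> smooth_alg" "\<forall>x. (f has_real_derivative f' x) (at x)"
      "g' \<in> smooth_alg" "\<forall>x. (g has_real_derivative g' x) (at x)" by blast
    then show ?case
      by (intro bexI[where x="\<lambda>x. f' x + g' x"]) (auto intro: DERIV_add smooth_alg.add)
  next
    case (mult f g)
    then obtain f' g' where "f' \<in> smooth_alg" "\<forall>x. (f has_real_derivative f' x) (at x)"
      "g' \<in> smooth_alg" "\<forall>x. (g has_real_derivative g' x) (at x)" by blast
    then show ?case
      using mult by (intro bexI[where x="\<lambda>x. f' x * g x + g' x * f x"])
        (auto intro: DERIV_mult smooth_alg.add smooth_alg.mult)
  qed
qed

lemma smooth_add: "smooth f \<Longrightarrow> smooth g \<Longrightarrow> smooth (\<lambda>x. f x + g x)"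
  and smooth_mult: "smooth f \<Longrightarrow> smooth g \<Longrightarrow> smooth (\<lambda>x. f x * g x)"
  by (simp_all add: smooth_alg_imp_smooth smooth_alg.intros)

lemma smooth_poly: "smooth (poly P)"
  by (rule smoothI_class[where S="range poly"]) (auto intro: poly_DERIV)

lemma smooth_const: "smooth (\<lambda>x. c)"
proof -
  have "poly [:c:] = (\<lambda>x. c)" by auto
  then show ?thesis using smooth_poly[of "[:c:]"] by simp
qed

lemma smooth_diff: "smooth f \<Longrightarrow> smooth g \<Longrightarrow> smooth (\<lambda>x. f x - g x)"
  using smooth_add[of f "\<lambda>x. (-1) * g x"] smooth_mult[OF smooth_const, of g "-1"] by simp

lemma smooth_continuous_on: "smooth f \<Longrightarrow> continuous_on S f"
  by (meson smooth_has_real_derivative DERIV_isCont continuous_at_imp_continuous_on)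

lemma smooth_flat_affine: "smooth (\<lambda>x. flat P (s * x + t))"
proof (rule smoothI_class[where S="{\<lambda>x. flat P (s * x + t) | P. True}"])
  fix g assume "g \<in> {\<lambda>x. flat P (s * x + t) | P. True}"
  then obtain P where g: "g = (\<lambda>x. flat P (s * x + t))" by blast
  have "(g has_real_derivative flat (smult s (flat_pderiv P)) (s * x + t)) (at x)" for x
    unfolding g by (rule DERIV_cong[OF DERIV_chain2[OF flat_has_real_derivative]])
      (auto intro!: derivative_eq_intros simp: flat_def)
  then show "\<exists>g'\<in>{\<lambda>x. flat P (s * x + t) | P. True}. \<forall>x. (g has_real_derivative g' x) (at x)"
    by (intro bexI[where x="\<lambda>x. flat (smult s (flat_pderiv P)) (s * x + t)"]) auto
qed auto

text \<open>Dilating by \<open>Suc n\<close> steepens both flanks: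
  \<open>exp (- 1 / (N * u))\<close> tends to 1 for each fixed \<open>u > 0\<close> as
  \<open>N\<close> grows, while the support stays in \<open>{c..d}\<close>.\<close>

definition bump :: "real \<Rightarrow> real \<Rightarrow> nat \<Rightarrow> real \<Rightarrow> real" where
  "bump c d n x = flat 1 (real (Suc n) * (x - c)) * flat 1 (real (Suc n) * (d - x))"

lemma smooth_bump: "smooth (bump c d n)"
  using smooth_mult[OF smooth_flat_affine[of 1 "real (Suc n)" "- real (Suc n) * c"]
      smooth_flat_affine[of 1 "- real (Suc n)" "real (Suc n) * d"]]
  by (simp add: bump_def[abs_def] algebra_simps)

lemma flat_1_bounds: "0 \<le> flat 1 x" "flat 1 x \<le> 1"
  by (auto simp: flat_def)

lemma bump_bounds: "0 \<le> bump c d n x" "bump c d n x \<le> 1"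
  unfolding bump_def by (auto intro!: mult_nonneg_nonneg mult_le_one flat_1_bounds)

lemma bump_pos: "c < x \<Longrightarrow> x < d \<Longrightarrow> 0 < bump c d n x"
  by (simp add: bump_def flat_def)

lemma bump_eq_0: "x \<notin> {c<..<d} \<Longrightarrow> bump c d n x = 0"
  by (auto simp: bump_def flat_def zero_less_mult_iff)

text \<open>Moving endpoints are allowed so that the supports can remain strictly inside an interval
  and still exhaust it.\<close>

lemma bump_tendsto_1:
  assumes "c \<longlonglongrightarrow> c'" "d \<longlonglongrightarrow> d'" "c' < x" "x < d'"
  shows "(\<lambda>n. bump (c n) (d n) n x) \<longlonglongrightarrow> 1"
proof -
  have *: "(\<lambda>n. flat 1 (real (Suc n) * u n)) \<longlonglongrightarrow> 1" if "u \<longlonglongrightarrow> v" "v > 0" for u v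
  proof -
    have "(\<lambda>n. exp (- (inverse (real (Suc n)) * (1 / u n)))) \<longlonglongrightarrow> exp (- (0 * (1 / v)))"
      by (intro tendsto_intros LIMSEQ_inverse_real_of_nat that) (use that in auto)
    moreover have "\<forall>\<^sub>F n in sequentially. exp (- (inverse (real (Suc n)) * (1 / u n))) = flat 1 (real (Suc n) * u n)"
      using order_tendstoD(1)[OF that]
    proof eventually_elim
      case (elim n)
      then have "0 < real (Suc n) * u n" by simp
      with elim show ?case by (simp add: flat_def divide_simps)
    qed
    ultimately show ?thesis using Lim_transform_eventually by fastforce
  qed
  have "(\<lambda>n. x - c n) \<longlonglongrightarrow> x - c'" "(\<lambda>n. d n - x) \<longlonglongrightarrow> d' - x"
    using assms by (auto intro: tendsto_intros)
  from tendsto_mult[OF *[OF this(1)] *[OF this(2)]] assms show ?thesis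
    by (simp add: bump_def)
qed

section \<open>Test functions and their supports\<close>

lemma test_functionsI:
  assumes "smooth f" "a < c" "d < b" "\<And>x. x \<notin> {c..d} \<Longrightarrow> f x = 0"
  shows "f \<in> test_functions a b"
proof -
  have "closure {x. f x \<noteq> 0} \<subseteq> {c..d}"
    using assms(4) by (intro closure_minimal subsetI closed_atLeastAtMost) blast
  then show ?thesis
    using assms by (auto simp: test_functions_def smooth_def)
qed

lemma test_functionsE:
  assumes "f \<in> test_functions a b" "a < b"
  obtains c d where "smooth f" "a < c" "c < d" "d < b" "\<And>x. x \<notin> {c..d} \<Longrightarrow> f x = 0"
proof -
  define S where "S = closure {x. f x \<noteq> 0}"
  have S: "S \<subseteq> {a<..<b}" "smooth f" and cl: "closed S"
    using assms(1) by (auto simp: test_functions_def smooth_def S_def)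
  have z: "f x = 0" if "x \<notin> S" for x
    using that closure_subset[of "{x. f x \<noteq> 0}"] by (auto simp: S_def)
  show thesis
  proof (cases "S = {}")
    case True
    obtain c d where "a < c" "c < d" "d < b" using assms(2) by (meson dense)
    with True S z show thesis by (intro that[of c d]) auto
  next
    case False
    have "bounded S" by (rule bounded_subset[OF _ S(1)]) auto
    then have "compact S" using cl by (simp add: compact_eq_bounded_closed)
    then obtain c d where cd: "c \<in> S" "d \<in> S" "\<And>x. x \<in> S \<Longrightarrow> c \<le> x \<and> x \<le> d"
      using compact_attains_inf[of S] compact_attains_sup[of S] False by metis
    \<comment> \<open>\<open>S\<close> might be a single point, with \<open>c = d\<close>; a larger
      right end ensures the strict inequality.\<close>
    obtain d' where "d < d'" "d' < b" using cd S by (meson dense greaterThanLessThan_iff subsetD)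
    show thesis
    proof (rule that[of c d'])
      show "a < c" "c < d'" using S cd \<open>d < d'\<close> by force+
      show "f x = 0" if "x \<notin> {c..d'}" for x
        using z[of x] cd(3)[of x] that \<open>d < d'\<close> by force
    qed (use S \<open>d' < b\<close> in auto)
  qed
qed

lemma bump_test_function: "a < c \<Longrightarrow> d < b \<Longrightarrow> bump c d n \<in> test_functions a b"
  by (rule test_functionsI[of _ _ c d]) (auto simp: smooth_bump intro!: bump_eq_0)

subsection \<open>The fundamental lemma and uniqueness of weak derivatives\<close>

lemma lebesgue_on_support:
  fixes f :: "real \<Rightarrow> real"
  assumes "S \<in> sets lebesgue" "T \<in> sets lebesgue" "T \<subseteq> S" "\<And>x. x \<in> S - T \<Longrightarrow> f x = 0"
  shows "integrable (lebesgue_on S) f \<longleftrightarrow> integrable (lebesgue_on T) f"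
    and "(LINT x|lebesgue_on S. f x) = (LINT x|lebesgue_on T. f x)"
proof -
  have eq: "(\<lambda>x. if x \<in> S then f x else 0) = (\<lambda>x. if x \<in> T then f x else 0)"
    using assms(3,4) by (auto simp: fun_eq_iff)
  show "integrable (lebesgue_on S) f \<longleftrightarrow> integrable (lebesgue_on T) f"
    using Lebesgue_Measure.integrable_restrict_UNIV[OF assms(1), of f]
      Lebesgue_Measure.integrable_restrict_UNIV[OF assms(2), of f]
    by (simp add: eq)
  show "(LINT x|lebesgue_on S. f x) = (LINT x|lebesgue_on T. f x)"
    using Lebesgue_Measure.integral_restrict_UNIV[OF assms(1), of f]
      Lebesgue_Measure.integral_restrict_UNIV[OF assms(2), of f]
    by (simp add: eq)
qed

lemma integrable_mult_continuous:
  fixes k f :: "real \<Rightarrow> real"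
  assumes "integrable (lebesgue_on {c..d}) k" "continuous_on {c..d} f"
  shows "integrable (lebesgue_on {c..d}) (\<lambda>x. k x * f x)"
proof -
  obtain M where M: "\<And>x. x \<in> {c..d} \<Longrightarrow> \<bar>f x\<bar> \<le> M"
    using compact_imp_bounded[OF compact_continuous_image[OF assms(2) compact_Icc]]
    by (force simp: bounded_iff)
  have f: "f \<in> borel_measurable (lebesgue_on {c..d})"
    using assms(2) by (simp add: continuous_imp_measurable_on_sets_lebesgue)
  show ?thesis
  proof (rule Bochner_Integration.integrable_bound[of _ "\<lambda>x. M * \<bar>k x\<bar>"])
    show "integrable (lebesgue_on {c..d}) (\<lambda>x. M * \<bar>k x\<bar>)" using assms(1) by simp
    show "(\<lambda>x. k x * f x) \<in> borel_measurable (lebesgue_on {c..d})"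
      using assms(1) f by measurable
    have "\<bar>k x\<bar> * \<bar>f x\<bar> \<le> \<bar>M\<bar> * \<bar>k x\<bar>" if "x \<in> {c..d}" for x
      using mult_right_mono[of "\<bar>f x\<bar>" "\<bar>M\<bar>" "\<bar>k x\<bar>"] M[OF that] by (simp add: mult.commute)
    then show "AE x in lebesgue_on {c..d}. norm (k x * f x) \<le> norm (M * \<bar>k x\<bar>)"
      by (intro AE_I2) (auto simp: abs_mult)
  qed
qed

lemma locally_integrable_Icc:
  assumes "locally_integrable {a<..<b} k" "a < c" "d < b"
  shows "integrable (lebesgue_on {c..d}) k"
proof -
  have "{c..d} \<subseteq> {a<..<b}" using assms by auto
  then show ?thesis using assms(1) compact_Icc unfolding locally_integrable_def by blast
qed

lemma locally_integrable_mult_supported: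
  assumes "locally_integrable {a<..<b} k" "a < c" "d < b"
    and "continuous_on {c..d} f" "\<And>x. x \<notin> {c..d} \<Longrightarrow> f x = 0"
  shows "integrable (lebesgue_on {a<..<b}) (\<lambda>x. k x * f x)"
    and "(LINT x|lebesgue_on {a<..<b}. k x * f x) = (LINT x|lebesgue_on {c..d}. k x * f x)"
proof -
  have "{c..d} \<subseteq> {a<..<b}" using assms by auto
  moreover have "integrable (lebesgue_on {c..d}) (\<lambda>x. k x * f x)"
    using assms \<open>{c..d} \<subseteq> {a<..<b}\<close> by (intro integrable_mult_continuous) (auto simp: locally_integrable_def)
  ultimately show "integrable (lebesgue_on {a<..<b}) (\<lambda>x. k x * f x)"
    "(LINT x|lebesgue_on {a<..<b}. k x * f x) = (LINT x|lebesgue_on {c..d}. k x * f x)"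
    using lebesgue_on_support[of "{a<..<b}" "{c..d}" "\<lambda>x. k x * f x"] assms(5) by auto
qed

lemma locally_integrable_mult_test:
  assumes "locally_integrable {a<..<b} k" "\<phi> \<in> test_functions a b" "a < b"
  shows "integrable (lebesgue_on {a<..<b}) (\<lambda>x. k x * \<phi> x)"
  using test_functionsE[OF assms(2,3)] locally_integrable_mult_supported(1)[OF assms(1)]
    smooth_continuous_on by metis

text \<open>The bumps converge boundedly to the indicator of \<open>(c,d)\<close>, so no mollification is needed.\<close>

lemma integral_eq_0_if_test_integrals_eq_0:
  assumes "locally_integrable {a<..<b} k"
    and "\<And>\<phi>. \<phi> \<in> test_functions a b \<Longrightarrow> (LINT x|lebesgue_on {a<..<b}. k x * \<phi> x) = 0"
    and "a < c" "d < b"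
  shows "integral {c..d} k = 0"
proof -
  have k: "integrable (lebesgue_on {c..d}) k"
    using assms(1,3,4) by (intro locally_integrable_Icc)
  have 0: "(LINT x|lebesgue_on {c..d}. k x * bump c d n x) = 0" for n
    using locally_integrable_mult_supported(2)[OF assms(1,3,4), of "bump c d n"]
      assms(2)[OF bump_test_function[OF assms(3,4)]] smooth_continuous_on[OF smooth_bump]
      bump_eq_0[of _ c d n] by force
  \<comment> \<open>Every bump vanishes at \<open>c\<close> and \<open>d\<close>, so the convergence
    to 1 has to leave out these two points.\<close>
  have ae: "AE x in lebesgue_on {c..d}. x \<notin> {c, d}"
    by (rule AE_I'[of "{c, d} \<inter> {c..d}"])
      (auto simp: null_sets_restrict_space negligible_iff_null_sets[symmetric] intro: negligible_subset[of "{c,d}"])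
  have "(\<lambda>n. LINT x|lebesgue_on {c..d}. k x * bump c d n x) \<longlonglongrightarrow> (LINT x|lebesgue_on {c..d}. k x)"
  proof (rule integral_dominated_convergence[where w="\<lambda>x. \<bar>k x\<bar>"])
    show "AE x in lebesgue_on {c..d}. (\<lambda>n. k x * bump c d n x) \<longlonglongrightarrow> k x"
      using ae AE_space
    proof eventually_elim
      case (elim x)
      then have "(\<lambda>n. k x * bump c d n x) \<longlonglongrightarrow> k x * 1"
        by (intro tendsto_intros bump_tendsto_1[of "\<lambda>_. c" c "\<lambda>_. d" d]) auto
      then show ?case by simp
    qed
    show "AE x in lebesgue_on {c..d}. norm (k x * bump c d n x) \<le> \<bar>k x\<bar>" for n
      using bump_bounds[of c d n] by (intro AE_I2) (simp add: abs_mult mult_left_le)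
    show "(\<lambda>x. k x * bump c d n x) \<in> borel_measurable (lebesgue_on {c..d})" for n
      using integrable_mult_continuous[OF k smooth_continuous_on[OF smooth_bump]] by auto
  qed (use k in auto)
  then have "(LINT x|lebesgue_on {c..d}. k x) = 0"
    unfolding 0 by (simp add: LIMSEQ_const_iff)
  then show ?thesis
    using k lebesgue_integral_eq_integral[OF k] by simp
qed

text \<open>Lebesgue differentiation: for almost every \<open>x\<close> the averages over
  \<open>{x..x + h}\<close>, which all vanish here, tend to \<open>f x\<close>.\<close>

lemma negligible_if_integrals_eq_0:
  fixes f :: "real \<Rightarrow> real"
  assumes "\<And>c d. f integrable_on {c..d}" "\<And>c d. integral {c..d} f = 0"
  shows "negligible {x. f x \<noteq> 0}"
proof -
  obtain N where N: "negligible N" "\<And>x e. \<lbrakk>x \<notin> N; 0 < e\<rbrakk> \<Longrightarrow>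
      \<exists>d>0. \<forall>h. 0 < h \<and> h < d \<longrightarrow> norm (integral (cbox x (x + h *\<^sub>R One)) f /\<^sub>R h ^ DIM(real) - f x) < e"
    using integrable_ccontinuous_explicit[of f] assms(1) by (metis box_real(2))
  have "f x = 0" if "x \<notin> N" for x :: real
  proof (rule ccontr)
    assume "f x \<noteq> 0"
    then obtain d where d: "d > 0" "\<forall>h. 0 < h \<and> h < d \<longrightarrow>
       norm (integral (cbox x (x + h *\<^sub>R One)) f /\<^sub>R h ^ DIM(real) - f x) < \<bar>f x\<bar>"
      using N(2)[OF \<open>x \<notin> N\<close>, of "\<bar>f x\<bar>"] by auto
    from d(2)[rule_format, of "d/2"] d(1) assms(2) show False by simp
  qed
  then show ?thesis by (intro negligible_subset[OF N(1)]) auto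
qed

lemma fundamental_lemma_calculus_of_variations:
  assumes li: "locally_integrable {a<..<b} k"
    and "\<And>\<phi>. \<phi> \<in> test_functions a b \<Longrightarrow> (LINT x|lebesgue_on {a<..<b}. k x * \<phi> x) = 0"
  shows "AE x in lebesgue_on {a<..<b}. k x = 0"
proof -
  have *: "negligible {x \<in> {c..d}. k x \<noteq> 0}" if "a < c" "d < b" for c d
  proof -
    \<comment> \<open>The cut-off makes \<open>k\<close> integrable on every interval, and the
      integral over \<open>{p..q}\<close> becomes one over a subinterval of
      \<open>{c..d}\<close>.\<close>
    define f where "f x = (if x \<in> {c..d} then k x else 0)" for x
    have "integrable (lebesgue_on {c..d}) k"
      using li that by (intro locally_integrable_Icc)
    then have k: "k integrable_on {c..d}"
      by (intro integrable_on_lebesgue_on) auto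
    have "f integrable_on {p..q} \<and> integral {p..q} f = 0" for p q
    proof -
      have "{c..d} \<inter> {p..q} = {max p c..min q d}" by auto
      moreover have "k integrable_on {max p c..min q d}"
        by (rule integrable_on_subinterval[OF k]) auto
      moreover have "integral {max p c..min q d} k = 0"
        using that by (intro integral_eq_0_if_test_integrals_eq_0[OF assms]) auto
      ultimately show ?thesis
        by (simp only: f_def[abs_def] integrable_restrict_Int Henstock_Kurzweil_Integration.integral_restrict_Int)
    qed
    then have "negligible {x. f x \<noteq> 0}"
      by (intro negligible_if_integrals_eq_0) auto
    then show ?thesis by (rule negligible_subset) (auto simp: f_def)
  qed
  \<comment> \<open>Local integrability gives control on compact subintervals only; countably many
    of them exhaust the open interval.\<close>
  have "negligible (\<Union>n. {x \<in> {a + inverse (real (Suc n))..b - inverse (real (Suc n))}. k x \<noteq> 0})"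
    using * by (intro negligible_countable_Union countable_image) (auto simp del: of_nat_Suc)
  moreover have "{x \<in> {a<..<b}. k x \<noteq> 0} \<subseteq> (\<Union>n. {x \<in> {a + inverse (real (Suc n))..b - inverse (real (Suc n))}. k x \<noteq> 0})"
  proof clarify
    fix x assume x: "x \<in> {a<..<b}" "k x \<noteq> 0"
    then obtain n where "inverse (real (Suc n)) < min (x - a) (b - x)"
      using reals_Archimedean[of "min (x - a) (b - x)"] by auto
    with x show "x \<in> (\<Union>n. {x \<in> {a + inverse (real (Suc n))..b - inverse (real (Suc n))}. k x \<noteq> 0})"
      by (intro UN_I[of n]) auto
  qed
  ultimately have "negligible {x \<in> {a<..<b}. k x \<noteq> 0}" by (rule negligible_subset)
  then show ?thesis
    by (intro AE_I'[of "{x \<in> {a<..<b}. k x \<noteq> 0}"])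
      (auto simp: null_sets_restrict_space negligible_iff_null_sets)
qed

lemma weak_deriv_unique:
  assumes "a < b" "has_weak_deriv a b u g" "has_weak_deriv a b u h"
  shows "AE x in lebesgue_on {a<..<b}. g x = h x"
proof -
  have li: "locally_integrable {a<..<b} g" "locally_integrable {a<..<b} h"
    using assms by (auto simp: has_weak_deriv_def)
  have "AE x in lebesgue_on {a<..<b}. g x - h x = 0"
  proof (rule fundamental_lemma_calculus_of_variations)
    show "locally_integrable {a<..<b} (\<lambda>x. g x - h x)"
      using li by (auto simp: locally_integrable_def)
    fix \<phi> assume t: "\<phi> \<in> test_functions a b"
    have "(LINT x|lebesgue_on {a<..<b}. g x * \<phi> x) = (LINT x|lebesgue_on {a<..<b}. h x * \<phi> x)"
      using assms(2,3) t by (simp add: has_weak_deriv_def)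
    then show "(LINT x|lebesgue_on {a<..<b}. (g x - h x) * \<phi> x) = 0"
      by (simp add: left_diff_distrib Bochner_Integration.integral_diff
          locally_integrable_mult_test[OF li(1) t \<open>a < b\<close>] locally_integrable_mult_test[OF li(2) t \<open>a < b\<close>])
  qed
  then show ?thesis by auto
qed

lemma has_weak_deriv_weak_deriv:
  "has_weak_deriv a b u g \<Longrightarrow> has_weak_deriv a b u (weak_deriv a b u)"
  unfolding weak_deriv_def by (rule someI[where P="has_weak_deriv a b u"])

text \<open>\<open>weak_deriv\<close> is an arbitrary choice. By uniqueness it may be replaced under
  an integral by any weak derivative that is known explicitly.\<close>

lemma weak_deriv_AE_eq:
  assumes "a < b" "has_weak_deriv a b u g"
  shows "AE x in lebesgue_on {a<..<b}. weak_deriv a b u x = g x"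
  using weak_deriv_unique[OF assms(1) has_weak_deriv_weak_deriv[OF assms(2)] assms(2)] .

subsection \<open>Functions of class \<open>C\<^sup>1\<close> vanishing at the boundary\<close>

lemma integrable_lebesgue_on_Ioo_iff:
  fixes f :: "real \<Rightarrow> real"
  shows "integrable (lebesgue_on {a<..<b}) f \<longleftrightarrow> integrable (lebesgue_on {a..b}) f"
proof -
  have "integrable (lebesgue_on S) f \<longleftrightarrow> f absolutely_integrable_on S" if "S \<in> sets lebesgue" for S
    using that by (simp add: integrable_restrict_space set_integrable_def)
  then show ?thesis by (simp add: absolutely_integrable_on_Icc_iff_Ioo)
qed

lemma borel_measurable_lebesgue_on_AE:
  fixes f g :: "real \<Rightarrow> real"
  assumes "f \<in> borel_measurable (lebesgue_on S)" "S \<in> sets lebesgue" "AE x in lebesgue_on S. f x = g x"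
  shows "g \<in> borel_measurable (lebesgue_on S)"
proof -
  have "AE x in lebesgue. x \<in> S \<longrightarrow> f x = g x"
    using assms(2,3) by (simp add: AE_restrict_space_iff)
  then have "AE x in lebesgue. (if x \<in> S then f x else 0) = (if x \<in> S then g x else 0)"
    by (rule eventually_mono) auto
  from borel_measurable_AE[OF borel_measurable_if_I[OF assms(1,2)] this] show ?thesis
    by (rule borel_measurable_if_D)
qed

lemma LINT_Ioo_eq_integral:
  fixes f :: "real \<Rightarrow> real"
  assumes "integrable (lebesgue_on {a<..<b}) f"
  shows "(LINT x|lebesgue_on {a<..<b}. f x) = integral {a..b} f"
  using lebesgue_integral_eq_integral[OF assms]
  by (simp add: integral_open_interval_real)

lemma LINT_Icc_eq_integral:
  fixes f :: "real \<Rightarrow> real"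
  assumes "integrable (lebesgue_on {a..b}) f"
  shows "(LINT x|lebesgue_on {a..b}. f x) = integral {a..b} f"
  using lebesgue_integral_eq_integral[OF assms] by simp

lemma AE_lebesgue_on_Icc_Ioo:
  fixes a b :: real
  shows "AE x in lebesgue_on {a..b}. x \<in> {a<..<b}"
  by (rule AE_I'[of "{a, b} \<inter> {a..b}"])
    (auto simp: null_sets_restrict_space negligible_iff_null_sets[symmetric] intro: negligible_subset[of "{a,b}"])

lemma integrable_bounded_lebesgue_on:
  fixes f :: "real \<Rightarrow> real"
  assumes "f \<in> borel_measurable (lebesgue_on {a..b})" "\<And>x. x \<in> {a..b} \<Longrightarrow> \<bar>f x\<bar> \<le> M"
  shows "integrable (lebesgue_on {a..b}) f"
proof (rule Bochner_Integration.integrable_bound[OF _ assms(1)])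
  show "integrable (lebesgue_on {a..b}) (\<lambda>x. M)" by (simp add: lmeasurable_iff_integrable finite_measure.integrable_const finite_measure_lebesgue_on)
qed (use assms(2) in \<open>force intro!: AE_I2\<close>)

lemma integrable_continuous_lebesgue_on:
  fixes f :: "real \<Rightarrow> real"
  assumes "continuous_on {a..b} f"
  shows "integrable (lebesgue_on {a..b}) f"
  using continuous_imp_integrable_real[OF assms] .

lemma bounded_convergence_integral:
  fixes f :: "nat \<Rightarrow> real \<Rightarrow> real"
  assumes "\<And>n. f n \<in> borel_measurable (lebesgue_on {a..b})" "g \<in> borel_measurable (lebesgue_on {a..b})"
    and "\<And>n x. x \<in> {a..b} \<Longrightarrow> \<bar>f n x\<bar> \<le> M"
    and "AE x in lebesgue_on {a..b}. (\<lambda>n. f n x) \<longlonglongrightarrow> g x"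
  shows "(\<lambda>n. integral {a..b} (f n)) \<longlonglongrightarrow> integral {a..b} g"
proof -
  have i: "integrable (lebesgue_on {a..b}) (\<lambda>x. M)"
    by (intro integrable_continuous_lebesgue_on continuous_intros)
  have b: "AE x in lebesgue_on {a..b}. norm (f n x) \<le> M" for n
    using assms(3) by (intro AE_I2) auto
  have "integrable (lebesgue_on {a..b}) (f n)" for n
    using integrable_dominated_convergence2[OF assms(2,1) i assms(4) b] .
  moreover have "integrable (lebesgue_on {a..b}) g"
    using integrable_dominated_convergence[OF assms(2,1) i assms(4) b] .
  ultimately show ?thesis
    using integral_dominated_convergence[OF assms(2,1) i assms(4) b]
    by (simp add: LINT_Icc_eq_integral)
qed

lemma locally_integrable_continuous:
  assumes "continuous_on {a..b} (f :: real \<Rightarrow> real)"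
  shows "locally_integrable {a<..<b} f"
  unfolding locally_integrable_def
proof (intro allI impI)
  fix K assume K: "compact K \<and> K \<subseteq> {a<..<b}"
  then have "K \<in> sets lebesgue" "K \<subseteq> {a..b}" by (auto intro: lmeasurable_compact fmeasurableD)
  moreover have "f absolutely_integrable_on {a..b}"
    using assms by (rule absolutely_integrable_continuous_real)
  ultimately show "integrable (lebesgue_on K) f"
    by (metis absolutely_integrable_imp_integrable set_integrable_subset)
qed

lemma test_function_deriv_continuous:
  "a < b \<Longrightarrow> \<phi> \<in> test_functions a b \<Longrightarrow> continuous_on S (deriv \<phi>)"
  by (meson smooth_continuous_on smooth_deriv test_functionsE)

lemma test_function_continuous:
  "a < b \<Longrightarrow> \<phi> \<in> test_functions a b \<Longrightarrow> continuous_on S \<phi>"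
  by (meson smooth_continuous_on test_functionsE)

lemma test_function_boundary:
  assumes "a < b" "\<phi> \<in> test_functions a b"
  shows "\<phi> a = 0" "\<phi> b = 0"
  using test_functionsE[OF assms(2,1)] by force+

lemma test_function_deriv:
  "a < b \<Longrightarrow> \<phi> \<in> test_functions a b \<Longrightarrow> (\<phi> has_real_derivative deriv \<phi> x) (at x)"
  by (meson smooth_has_real_derivative test_functionsE)

lemma integral_by_parts_test:
  assumes "a < b" "\<phi> \<in> test_functions a b"
    and "continuous_on {a..b} v" "continuous_on {a..b} v'"
    and "\<And>x. x \<in> {a<..<b} \<Longrightarrow> (v has_real_derivative v' x) (at x)"
  shows "integral {a..b} (\<lambda>x. v x * deriv \<phi> x) = - integral {a..b} (\<lambda>x. v' x * \<phi> x)"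
proof -
  have c: "continuous_on {a..b} \<phi>" "continuous_on {a..b} (deriv \<phi>)"
    using test_function_continuous[OF assms(1,2)] test_function_deriv_continuous[OF assms(1,2)] by auto
  have "((\<lambda>x. v' x * \<phi> x) has_integral (- integral {a..b} (\<lambda>x. v x * deriv \<phi> x))) {a..b}"
  proof (rule integration_by_parts_interior[OF bounded_bilinear_mult, where f=v and g'="deriv \<phi>"])
    have "(\<lambda>x. v x * deriv \<phi> x) integrable_on {a..b}"
      by (intro integrable_continuous_interval continuous_intros assms c)
    then show "((\<lambda>x. v x * deriv \<phi> x) has_integral
       v b * \<phi> b - v a * \<phi> a - - integral {a..b} (\<lambda>x. v x * deriv \<phi> x)) {a..b}"
      using test_function_boundary[OF assms(1,2)] by (simp add: integrable_integral)
  qed (use assms c test_function_deriv[OF assms(1,2)] in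
      \<open>auto simp: has_real_derivative_iff_has_vector_derivative[symmetric]\<close>)
  then show ?thesis by (simp add: integral_unique)
qed

lemma has_weak_deriv_C1:
  assumes "a < b"
    and "continuous_on {a..b} v" "continuous_on {a..b} v'"
    and "\<And>x. x \<in> {a<..<b} \<Longrightarrow> (v has_real_derivative v' x) (at x)"
  shows "has_weak_deriv a b v v'"
  unfolding has_weak_deriv_def
proof (intro conjI ballI)
  fix \<phi> assume t: "\<phi> \<in> test_functions a b"
  have "integrable (lebesgue_on {a<..<b}) (\<lambda>x. v x * deriv \<phi> x)"
    "integrable (lebesgue_on {a<..<b}) (\<lambda>x. v' x * \<phi> x)"
    unfolding integrable_lebesgue_on_Ioo_iff
    by (intro integrable_continuous_lebesgue_on continuous_intros assms
        test_function_continuous[OF assms(1) t] test_function_deriv_continuous[OF assms(1) t])+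
  then show "(LINT x|lebesgue_on {a<..<b}. v x * deriv \<phi> x) = - (LINT x|lebesgue_on {a<..<b}. v' x * \<phi> x)"
    using integral_by_parts_test[OF assms(1) t assms(2-4)] by (simp add: LINT_Ioo_eq_integral)
qed (use assms locally_integrable_continuous in auto)

lemma L2_continuous:
  assumes "continuous_on {a..b} (f :: real \<Rightarrow> real)"
  shows "f \<in> L2 {a<..<b}"
proof -
  have "integrable (lebesgue_on {a<..<b}) f" "integrable (lebesgue_on {a<..<b}) (\<lambda>x. (f x)\<^sup>2)"
    unfolding integrable_lebesgue_on_Ioo_iff
    by (intro integrable_continuous_lebesgue_on continuous_intros assms)+
  then show ?thesis by (auto simp: L2_def)
qed

lemma H1_C1:
  assumes "a < b"
    and "continuous_on {a..b} v" "continuous_on {a..b} v'"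
    and "\<And>x. x \<in> {a<..<b} \<Longrightarrow> (v has_real_derivative v' x) (at x)"
  shows "v \<in> H1 a b"
  using has_weak_deriv_C1[OF assms] L2_continuous assms by (auto simp: H1_def)

text \<open>This makes the norm computable: the chosen weak derivative agrees almost everywhere with
  the classical one, and inherits its measurability from it.\<close>

lemma H1_norm_C1:
  assumes "a < b"
    and "continuous_on {a..b} v" "continuous_on {a..b} v'"
    and "\<And>x. x \<in> {a<..<b} \<Longrightarrow> (v has_real_derivative v' x) (at x)"
  shows "H1_norm a b v = sqrt (integral {a..b} (\<lambda>x. (v x)\<^sup>2) + integral {a..b} (\<lambda>x. (v' x)\<^sup>2))"
proof -
  have wd0: "has_weak_deriv a b v v'"
    by (rule has_weak_deriv_C1) (use assms in auto)
  have wd: "has_weak_deriv a b v (weak_deriv a b v)"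
    using has_weak_deriv_weak_deriv[OF wd0] .
  have i: "integrable (lebesgue_on {a<..<b}) (\<lambda>x. (v x)\<^sup>2)"
    "integrable (lebesgue_on {a<..<b}) (\<lambda>x. (v' x)\<^sup>2)"
    using L2_continuous assms by (auto simp: L2_def)
  have ae: "AE x in lebesgue_on {a<..<b}. (v' x)\<^sup>2 = (weak_deriv a b v x)\<^sup>2"
    using weak_deriv_AE_eq[OF assms(1) wd0] by (rule eventually_mono) (rule arg_cong[where f="\<lambda>y. y\<^sup>2"], erule sym)
  have "(LINT x|lebesgue_on {a<..<b}. (weak_deriv a b v x)\<^sup>2) = (LINT x|lebesgue_on {a<..<b}. (v' x)\<^sup>2)"
  proof (rule integral_cong_AE[symmetric])
    show "(\<lambda>x. (weak_deriv a b v x)\<^sup>2) \<in> borel_measurable (lebesgue_on {a<..<b})"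
      by (rule borel_measurable_lebesgue_on_AE[OF _ _ ae]) (use i in auto)
  qed (use ae i in auto)
  then show ?thesis using i by (simp add: H1_norm_def LINT_Ioo_eq_integral)
qed

section \<open>Approximation by test functions in the Sobolev norm\<close>

lemma smooth_real_polynomial_function: "real_polynomial_function p \<Longrightarrow> smooth p"
  by (rule smoothI_class[where S="{p. real_polynomial_function p}"])
    (use has_real_derivative_polynomial_function in blast)+

text \<open>An antiderivative is constant to the left and to the right of the support of
  \<open>\<psi>\<close>. Mean value zero makes the two constants equal, so subtracting one of them
  leaves a compactly supported function.\<close>

lemma test_function_antiderivative:
  assumes "smooth \<psi>" "a < c" "c < d" "d < b" "\<And>x. x \<notin> {c..d} \<Longrightarrow> \<psi> x = 0" "integral {a..b} \<psi> = 0"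
  obtains \<phi> where "\<phi> \<in> test_functions a b" "\<And>x. (\<phi> has_real_derivative \<psi> x) (at x)"
    "\<And>x. x \<in> {a..b} \<Longrightarrow> \<phi> x = integral {a..x} \<psi>"
proof -
  obtain F where "\<And>x. (F has_vector_derivative \<psi> x) (at x)"
    using einterval_antiderivative[of "-\<infinity>" \<infinity> \<psi>] smooth_has_real_derivative[OF assms(1)]
    by (auto intro: DERIV_isCont)
  then have F: "(F has_real_derivative \<psi> x) (at x)" for x
    by (simp add: has_real_derivative_iff_has_vector_derivative)
  have ftc: "(\<psi> has_integral F y - F x) {x..y}" if "x \<le> y" for x y
    by (intro fundamental_theorem_of_calculus that)
      (use F in \<open>auto simp: has_real_derivative_iff_has_vector_derivative intro: has_vector_derivative_at_within\<close>)
  define \<phi> where "\<phi> x = F x - F a" for x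
  have \<phi>: "(\<phi> has_real_derivative \<psi> x) (at x)" for x
    unfolding \<phi>_def[abs_def] using DERIV_diff[OF F DERIV_const] by simp
  have const: "F x = F y" if "x \<le> y" "y \<le> c \<or> d \<le> x" for x y
  proof (cases "x = y")
    case False
    have "(\<psi> has_integral 0) {x..y}"
    \<comment> \<open>The endpoints are exempted because one of them may be \<open>c\<close> or
      \<open>d\<close>, where \<open>\<psi>\<close> is not assumed to vanish.\<close>
    proof (rule has_integral_spike_finite[where S="{x, y}" and f="\<lambda>x. 0"])
      show "\<psi> z = 0" if "z \<in> {x..y} - {x, y}" for z
        using assms(5)[of z] that \<open>y \<le> c \<or> d \<le> x\<close> by force
    qed auto
    from has_integral_unique[OF ftc[OF that(1)] this] show ?thesis by simp
  qed simp
  have "F b - F a = 0" using ftc[of a b] assms by (auto dest: integral_unique)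
  then have "\<phi> x = 0" if "x \<notin> {c..d}" for x
  proof -
    have "F x = F a" if "x < c"
      using const[of x a] const[of a x] that assms(2-4) by linarith
    moreover have "F x = F b" if "d < x"
      using const[of x b] const[of b x] that assms(2-4) by linarith
    ultimately show ?thesis
      using \<open>x \<notin> {c..d}\<close> \<open>F b - F a = 0\<close> by (fastforce simp: \<phi>_def)
  qed
  moreover have "smooth \<phi>" using smooth_antiderivative[OF assms(1) \<phi>] .
  ultimately have "\<phi> \<in> test_functions a b" using assms by (intro test_functionsI[of _ _ c d])
  moreover have "\<phi> x = integral {a..x} \<psi>" if "x \<in> {a..b}" for x
    using ftc[of a x] that by (auto simp: \<phi>_def dest: integral_unique)
  ultimately show thesis using that \<phi> by blast
qed

lemma borel_measurable_continuous_lebesgue_on_Icc: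
  "continuous_on {a..b} (f :: real \<Rightarrow> real) \<Longrightarrow> f \<in> borel_measurable (lebesgue_on {a..b})"
  by (simp add: continuous_imp_measurable_on_sets_lebesgue)

text \<open>The derivative is approximated by polynomials times bumps, and a multiple of a fixed bump
  restores mean value zero, so that the antiderivatives have compact support.\<close>

lemma test_derivative_approximation:
  assumes "a < b" "continuous_on {a..b} v'" "integral {a..b} v' = 0"
  obtains \<psi> c d M where "\<And>n. smooth (\<psi> n)" "\<And>n. a < c n" "\<And>n. c n < d n" "\<And>n. d n < b"
    "\<And>n x. x \<notin> {c n..d n} \<Longrightarrow> \<psi> n x = 0" "\<And>n. integral {a..b} (\<psi> n) = 0"
    "\<And>n x. x \<in> {a..b} \<Longrightarrow> \<bar>\<psi> n x\<bar> \<le> M" "\<And>x. x \<in> {a<..<b} \<Longrightarrow> (\<lambda>n. \<psi> n x) \<longlonglongrightarrow> v' x"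
proof -
  have "\<exists>P. real_polynomial_function P \<and> (\<forall>x\<in>{a..b}. \<bar>v' x - P x\<bar> < inverse (real (Suc n)))" for n
    by (rule Stone_Weierstrass_real_polynomial_function[OF compact_Icc assms(2), of "inverse (real (Suc n))"])
      (auto simp del: of_nat_Suc)
  then obtain P where P: "\<And>n. real_polynomial_function (P n)"
    "\<And>n x. x \<in> {a..b} \<Longrightarrow> \<bar>v' x - P n x\<bar> < inverse (real (Suc n))" by metis
  \<comment> \<open>With \<open>n + 3\<close> in the denominator even the widest margin
    \<open>e 0\<close> is a third of the length, so \<open>c n < d n\<close> from the start.\<close>
  define e where "e n = (b - a) / (real n + 3)" for n
  define c where "c n = a + e n" for n
  define d where "d n = b - e n" for n
  have "e \<longlonglongrightarrow> 0" unfolding e_def[abs_def] by real_asymp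
  then have cl: "c \<longlonglongrightarrow> a" "d \<longlonglongrightarrow> b"
    unfolding c_def[abs_def] d_def[abs_def]
    using tendsto_add[OF tendsto_const, of e 0 _ a] tendsto_diff[OF tendsto_const, of e 0 _ b] by auto
  have "0 < e n" "3 * e 0 = b - a" for n
    using assms(1) by (auto simp: e_def)
  moreover have "e n \<le> e 0" for n
    unfolding e_def using assms(1) by (intro divide_left_mono) auto
  ultimately have cd: "a < c n" "c n < d n" "d n < b" "c n \<le> c 0" "d 0 \<le> d n" for n
    unfolding c_def d_def using assms(1) by (smt (verit))+
  define \<beta> where "\<beta> n x = bump (c n) (d n) n x" for n x
  have \<beta>c: "continuous_on S (\<beta> n)" for S n
    unfolding \<beta>_def by (rule smooth_continuous_on[OF smooth_bump])
  have \<beta>b: "0 \<le> \<beta> n x" "\<beta> n x \<le> 1" for n x by (auto simp: \<beta>_def bump_bounds)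
  have Pc: "continuous_on S (P n)" for S n by (rule smooth_continuous_on[OF smooth_real_polynomial_function[OF P(1)]])
  define I where "I = integral {a..b} (\<beta> 0)"
  have "I > 0"
  proof -
    have "\<beta> 0 integrable_on {a..b}" by (intro integrable_continuous_interval \<beta>c)
    then have "I \<ge> 0" unfolding I_def by (intro integral_nonneg) (auto simp: \<beta>b)
    moreover have "I \<noteq> 0"
    proof
      assume "I = 0"
      then have "\<beta> 0 ((c 0 + d 0) / 2) = 0"
        using integral_eq_0_iff[of a b "\<beta> 0"] assms(1) \<beta>c \<beta>b cd(1,2,3)[of 0] by (auto simp: I_def)
      moreover have "\<beta> 0 ((c 0 + d 0) / 2) > 0"
        unfolding \<beta>_def using cd(2)[of 0] by (intro bump_pos) auto
      ultimately show False by simp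
    qed
    ultimately show ?thesis by simp
  qed
  obtain V where V: "\<And>x. x \<in> {a..b} \<Longrightarrow> \<bar>v' x\<bar> \<le> V"
    using compact_imp_bounded[OF compact_continuous_image[OF assms(2) compact_Icc]]
    by (force simp: bounded_iff)
  have V0: "V \<ge> 0" using V[of a] assms(1) by force
  define q where "q n x = P n x * \<beta> n x" for n x
  define \<kappa> where "\<kappa> n = integral {a..b} (q n)" for n
  \<comment> \<open>The corrector is bump number 0, whose support lies in \<open>{c n..d n}\<close>
    for every \<open>n\<close>. Its coefficient tends to 0 because \<open>\<kappa> n\<close> tends
    to the mean of \<open>v'\<close>, so neither support nor limit is disturbed.\<close>
  define \<psi> where "\<psi> n x = q n x - (\<kappa> n / I) * \<beta> 0 x" for n x
  have qc: "continuous_on S (q n)" for S n unfolding q_def by (intro continuous_intros Pc \<beta>c)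
  have qb: "\<bar>q n x\<bar> \<le> V + 1" if "x \<in> {a..b}" for n x
  proof -
    have "inverse (real (Suc n)) \<le> 1" by (simp add: field_simps)
    then have "\<bar>P n x\<bar> \<le> V + 1" using P(2)[OF that, of n] V[OF that] by linarith
    then have "\<bar>P n x\<bar> * \<bar>\<beta> n x\<bar> \<le> (V + 1) * 1" using \<beta>b V0 by (intro mult_mono) auto
    then show ?thesis by (simp add: q_def abs_mult)
  qed
  have ql: "(\<lambda>n. q n x) \<longlonglongrightarrow> v' x" if "x \<in> {a<..<b}" for x
  proof -
    have "(\<lambda>n. P n x) \<longlonglongrightarrow> v' x"
    proof (rule LIMSEQ_I)
      fix r :: real assume "0 < r"
      then obtain N where N: "inverse (real (Suc N)) < r" using reals_Archimedean by blast
      have "norm (P n x - v' x) < r" if "n \<ge> N" for n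
      proof -
        have "inverse (real (Suc n)) \<le> inverse (real (Suc N))" using that by simp
        moreover have "\<bar>v' x - P n x\<bar> < inverse (real (Suc n))"
          using \<open>x \<in> {a<..<b}\<close> by (intro P) auto
        ultimately show ?thesis using N unfolding real_norm_def by linarith
      qed
      then show "\<exists>no. \<forall>n\<ge>no. norm (P n x - v' x) < r" by blast
    qed
    from tendsto_mult[OF this bump_tendsto_1[OF cl]] that show ?thesis
      by (simp add: q_def \<beta>_def)
  qed
  have "(\<lambda>n. integral {a..b} (q n)) \<longlonglongrightarrow> integral {a..b} v'"
  proof (rule bounded_convergence_integral)
    show "AE x in lebesgue_on {a..b}. (\<lambda>n. q n x) \<longlonglongrightarrow> v' x"
      using AE_lebesgue_on_Icc_Ioo by (rule eventually_mono) (rule ql)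
  qed (use qb qc assms(2) borel_measurable_continuous_lebesgue_on_Icc in auto)
  then have \<kappa>l: "\<kappa> \<longlonglongrightarrow> 0" using assms(3) by (simp add: \<kappa>_def[abs_def])
  then obtain C where C: "\<And>n. \<bar>\<kappa> n\<bar> \<le> C" using convergent_imp_Bseq[OF convergentI] by (metis BseqE real_norm_def)
  show thesis
  proof
    show "smooth (\<psi> n)" for n
      unfolding \<psi>_def q_def \<beta>_def
      by (intro smooth_diff smooth_mult smooth_const smooth_bump smooth_real_polynomial_function P)
    show "\<psi> n x = 0" if "x \<notin> {c n..d n}" for n x
    proof -
      have "\<beta> n x = 0" "\<beta> 0 x = 0"
        unfolding \<beta>_def using that cd(4,5)[of n] by (auto intro!: bump_eq_0)
      then show ?thesis by (simp add: \<psi>_def q_def)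
    qed
    show "integral {a..b} (\<psi> n) = 0" for n
    proof -
      have "integral {a..b} (\<psi> n) = integral {a..b} (q n) - integral {a..b} (\<lambda>x. (\<kappa> n / I) * \<beta> 0 x)"
        unfolding \<psi>_def[abs_def] by (intro Henstock_Kurzweil_Integration.integral_diff integrable_continuous_interval continuous_intros qc \<beta>c)
      then show ?thesis using \<open>I > 0\<close> by (simp add: \<kappa>_def I_def)
    qed
    show "\<bar>\<psi> n x\<bar> \<le> (V + 1) + (C / I) * 1" if "x \<in> {a..b}" for n x
    proof -
      have "\<bar>\<kappa> n / I\<bar> * \<bar>\<beta> 0 x\<bar> \<le> (C / I) * 1"
        using C[of n] \<open>I > 0\<close> \<beta>b by (intro mult_mono) (auto simp: divide_right_mono)
      then show ?thesis using qb[OF that, of n] unfolding \<psi>_def abs_mult[symmetric] by linarith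
    qed
    show "(\<lambda>n. \<psi> n x) \<longlonglongrightarrow> v' x" if "x \<in> {a<..<b}" for x
    proof -
      have "(\<lambda>n. q n x - (\<kappa> n / I) * \<beta> 0 x) \<longlonglongrightarrow> v' x - (0 / I) * \<beta> 0 x"
        using \<open>I > 0\<close> by (intro tendsto_intros ql \<kappa>l that) auto
      then show ?thesis by (simp add: \<psi>_def)
    qed
  qed (use cd in auto)
qed

text \<open>Approximating the derivative controls both parts of the norm: as \<open>v a = 0\<close>,
  integrating from \<open>a\<close> turns bounded convergence of derivatives into that of the
  functions. Both boundary values together give \<open>v'\<close> mean value zero, as required for
  compactly supported antiderivatives.\<close>

lemma H10_C1:
  assumes ab: "a < b"
    and c: "continuous_on {a..b} v" "continuous_on {a..b} v'"
    and D: "\<And>x. x \<in> {a<..<b} \<Longrightarrow> (v has_real_derivative v' x) (at x)"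
    and z: "v a = 0" "v b = 0"
  shows "v \<in> H10 a b"
proof -
  have ftc: "(v' has_integral v y - v a) {a..y}" if "a \<le> y" "y \<le> b" for y
  proof (rule fundamental_theorem_of_calculus_interior[OF that(1)])
    show "continuous_on {a..y} v" by (rule continuous_on_subset[OF c(1)]) (use that in auto)
    show "(v has_vector_derivative v' x) (at x)" if "x \<in> {a<..<y}" for x
      using D[of x] that \<open>y \<le> b\<close> by (auto simp: has_real_derivative_iff_has_vector_derivative[symmetric])
  qed
  then have v: "v y = integral {a..y} v'" if "a \<le> y" "y \<le> b" for y
    using integral_unique[OF ftc[OF that]] z by simp
  have "integral {a..b} v' = 0" using v[of b] z ab by simp
  from test_derivative_approximation[OF ab c(2) this] obtain \<psi> c' d' M where
    \<psi>: "\<And>n. smooth (\<psi> n)" "\<And>n. a < c' n" "\<And>n. c' n < d' n" "\<And>n. d' n < b"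
    "\<And>n x. x \<notin> {c' n..d' n} \<Longrightarrow> \<psi> n x = 0" "\<And>n. integral {a..b} (\<psi> n) = 0"
    and M: "\<And>n x. x \<in> {a..b} \<Longrightarrow> \<bar>\<psi> n x\<bar> \<le> M"
    and \<psi>l: "\<And>x. x \<in> {a<..<b} \<Longrightarrow> (\<lambda>n. \<psi> n x) \<longlonglongrightarrow> v' x" by metis
  have "\<exists>\<phi>. \<phi> \<in> test_functions a b \<and> (\<forall>x. (\<phi> has_real_derivative \<psi> n x) (at x)) \<and>
    (\<forall>x\<in>{a..b}. \<phi> x = integral {a..x} (\<psi> n))" for n
    by (rule test_function_antiderivative[OF \<psi>(1-4)[of n] \<psi>(5)[of _ n] \<psi>(6)[of n]]) auto
  then obtain \<phi> where \<phi>: "\<And>n. \<phi> n \<in> test_functions a b" "\<And>n x. (\<phi> n has_real_derivative \<psi> n x) (at x)"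
    "\<And>n x. x \<in> {a..b} \<Longrightarrow> \<phi> n x = integral {a..x} (\<psi> n)" by metis
  have \<psi>c: "continuous_on S (\<psi> n)" for S n using smooth_continuous_on[OF \<psi>(1)] .
  have \<phi>c: "continuous_on S (\<phi> n)" for S n using test_function_continuous[OF ab \<phi>(1)] .
  have ael: "AE x in lebesgue_on {a..y}. (\<lambda>n. \<psi> n x) \<longlonglongrightarrow> v' x" if "y \<le> b" for y
    using AE_lebesgue_on_Icc_Ioo by (rule eventually_mono) (use that \<psi>l in auto)
  have \<phi>l: "(\<lambda>n. \<phi> n x) \<longlonglongrightarrow> v x" if "x \<in> {a..b}" for x
  proof -
    have "(\<lambda>n. integral {a..x} (\<psi> n)) \<longlonglongrightarrow> integral {a..x} v'"
    proof (rule bounded_convergence_integral[where M=M, OF _ _ _ ael])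
      show "v' \<in> borel_measurable (lebesgue_on {a..x})"
        by (intro borel_measurable_continuous_lebesgue_on_Icc continuous_on_subset[OF c(2)]) (use that in auto)
    qed (use that M \<psi>c borel_measurable_continuous_lebesgue_on_Icc in auto)
    then show ?thesis using that \<phi>(3) v by simp
  qed
  obtain V where V: "\<And>x. x \<in> {a..b} \<Longrightarrow> \<bar>v' x\<bar> \<le> V"
    using compact_imp_bounded[OF compact_continuous_image[OF c(2) compact_Icc]]
    by (force simp: bounded_iff)
  obtain W where W: "\<And>x. x \<in> {a..b} \<Longrightarrow> \<bar>v x\<bar> \<le> W"
    using compact_imp_bounded[OF compact_continuous_image[OF c(1) compact_Icc]]
    by (force simp: bounded_iff)
  have \<phi>b: "\<bar>\<phi> n x\<bar> \<le> M * (b - a)" if "x \<in> {a..b}" for n x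
  proof -
    have "norm (integral {a..x} (\<psi> n)) \<le> M * (x - a)"
      by (rule integral_bound) (use that M \<psi>c in auto)
    also have "\<dots> \<le> M * (b - a)" using M[of a 0] ab that by (intro mult_left_mono) auto
    finally show ?thesis using \<phi>(3)[OF that] by simp
  qed
  have l: "(\<lambda>n. integral {a..b} (\<lambda>x. (g x - f n x)\<^sup>2)) \<longlonglongrightarrow> 0"
    if g: "continuous_on {a..b} g" "\<And>x. x \<in> {a..b} \<Longrightarrow> \<bar>g x\<bar> \<le> G"
      and f: "\<And>n. continuous_on {a..b} (f n)" "\<And>n x. x \<in> {a..b} \<Longrightarrow> \<bar>f n x\<bar> \<le> F"
      and l: "\<And>x. x \<in> {a<..<b} \<Longrightarrow> (\<lambda>n. f n x) \<longlonglongrightarrow> g x" for f :: "nat \<Rightarrow> real \<Rightarrow> real" and g G F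
  proof -
    have "(\<lambda>n. integral {a..b} (\<lambda>x. (g x - f n x)\<^sup>2)) \<longlonglongrightarrow> integral {a..b} (\<lambda>x. 0)"
    proof (rule bounded_convergence_integral[where M="(G + F)\<^sup>2"])
      show "(\<lambda>x. (g x - f n x)\<^sup>2) \<in> borel_measurable (lebesgue_on {a..b})" for n
        by (intro borel_measurable_continuous_lebesgue_on_Icc continuous_intros f g)
      show "\<bar>(g x - f n x)\<^sup>2\<bar> \<le> (G + F)\<^sup>2" if "x \<in> {a..b}" for n x
        using g(2)[OF that] f(2)[OF that, of n] by (auto intro!: abs_le_square_iff[THEN iffD1])
      show "AE x in lebesgue_on {a..b}. (\<lambda>n. (g x - f n x)\<^sup>2) \<longlonglongrightarrow> 0"
        using AE_lebesgue_on_Icc_Ioo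
      proof (rule eventually_mono)
        fix x assume "x \<in> {a<..<b}"
        then have "(\<lambda>n. (g x - f n x)\<^sup>2) \<longlonglongrightarrow> (g x - g x)\<^sup>2" by (intro tendsto_intros l)
        then show "(\<lambda>n. (g x - f n x)\<^sup>2) \<longlonglongrightarrow> 0" by simp
      qed
    qed auto
    then show ?thesis by simp
  qed
  have "H1_norm a b (\<lambda>x. v x - \<phi> n x) =
      sqrt (integral {a..b} (\<lambda>x. (v x - \<phi> n x)\<^sup>2) + integral {a..b} (\<lambda>x. (v' x - \<psi> n x)\<^sup>2))" for n
    by (rule H1_norm_C1) (use ab c \<phi>c \<psi>c D \<phi>(2) in \<open>auto intro!: continuous_intros DERIV_diff\<close>)
  moreover have "(\<lambda>n. sqrt (integral {a..b} (\<lambda>x. (v x - \<phi> n x)\<^sup>2) + integral {a..b} (\<lambda>x. (v' x - \<psi> n x)\<^sup>2)))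
      \<longlonglongrightarrow> sqrt (0 + 0)"
  proof (intro tendsto_intros)
    show "(\<lambda>n. integral {a..b} (\<lambda>x. (v x - \<phi> n x)\<^sup>2)) \<longlonglongrightarrow> 0"
      by (rule l[OF c(1) W \<phi>c \<phi>b]) (use \<phi>l in auto)
    show "(\<lambda>n. integral {a..b} (\<lambda>x. (v' x - \<psi> n x)\<^sup>2)) \<longlonglongrightarrow> 0"
      by (rule l[OF c(2) V \<psi>c M]) (use \<psi>l in auto)
  qed
  ultimately have lim: "(\<lambda>n. H1_norm a b (\<lambda>x. v x - \<phi> n x)) \<longlonglongrightarrow> 0" by simp
  have "\<exists>\<phi>\<in>test_functions a b. H1_norm a b (\<lambda>x. v x - \<phi> x) < \<epsilon>" if "\<epsilon> > 0" for \<epsilon>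
    using order_tendstoD(2)[OF lim that] \<phi>(1) by (auto simp: eventually_sequentially)
  moreover have "v \<in> H1 a b" by (rule H1_C1[OF ab c D])
  ultimately show ?thesis by (simp add: H10_def)
qed

subsection \<open>Weak equations from integrated ones\<close>

lemma integrable_on_lebesgue_on_bounded:
  fixes g :: "real \<Rightarrow> real"
  assumes "g \<in> borel_measurable (lebesgue_on {a..b})" "\<And>x. x \<in> {a..b} \<Longrightarrow> \<bar>g x\<bar> \<le> M"
  shows "g integrable_on {a..b}"
  using integrable_bounded_lebesgue_on[OF assms] by (intro integrable_on_lebesgue_on) auto

text \<open>The library's integration by parts needs a derivative off a countable set, which an indefinite
  integral of a merely measurable \<open>g\<close> need not have; hence the approximation of \<open>g\<close> by continuous
  functions.\<close>

lemma integral_by_parts_indefinite_integral: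
  assumes "a < b" "\<phi> \<in> test_functions a b"
    and g: "g \<in> borel_measurable (lebesgue_on {a..b})" "\<And>x. x \<in> {a..b} \<Longrightarrow> \<bar>g x\<bar> \<le> M"
  shows "integral {a..b} (\<lambda>x. (K + integral {a..x} g) * deriv \<phi> x) = - integral {a..b} (\<lambda>x. g x * \<phi> x)"
proof -
  have \<phi>c: "continuous_on S \<phi>" "continuous_on S (deriv \<phi>)" for S
    using test_function_continuous[OF assms(1,2)] test_function_deriv_continuous[OF assms(1,2)] by auto
  obtain N f where N: "negligible N" and f: "\<And>n. continuous_on UNIV (f n)"
    "\<And>x. x \<notin> N \<Longrightarrow> (\<lambda>n. f n x) \<longlonglongrightarrow> (if x \<in> {a..b} then g x else 0)"
    using measurable_on_iff_borel_measurable[of "{a..b}" g] g(1) unfolding measurable_on_def by auto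
  \<comment> \<open>Clipping at the bound of \<open>g\<close> leaves the limit unchanged and makes
    the continuous approximants uniformly bounded.\<close>
  define h where "h n x = max (- M) (min M (f n x))" for n x
  have M0: "M \<ge> 0" using g(2)[of a] assms(1) by force
  have hc: "continuous_on S (h n)" for S n
    unfolding h_def by (intro continuous_intros continuous_on_subset[OF f(1)]) auto
  have hb: "\<bar>h n x\<bar> \<le> M" for n x using M0 by (auto simp: h_def)
  have hl: "(\<lambda>n. h n x) \<longlonglongrightarrow> g x" if "x \<in> {a..b}" "x \<notin> N" for x
  proof -
    have "(\<lambda>n. h n x) \<longlonglongrightarrow> max (- M) (min M (g x))"
      unfolding h_def using f(2)[OF that(2)] that(1) by (intro tendsto_intros) auto
    then show ?thesis using g(2)[OF that(1)] by (simp add: min_def max_def abs_le_iff split: if_splits)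
  qed
  have ae: "AE x in lebesgue_on {a..y}. (\<lambda>n. h n x) \<longlonglongrightarrow> g x" if "y \<le> b" for y
  proof (rule AE_I'[of "N \<inter> {a..y}"])
    show "N \<inter> {a..y} \<in> null_sets (lebesgue_on {a..y})"
      using N by (auto simp: null_sets_restrict_space negligible_iff_null_sets[symmetric] intro: negligible_subset)
  qed (use hl that in force)
  define G where "G y = integral {a..y} g" for y
  define H where "H n y = integral {a..y} (h n)" for n y
  have Hl: "(\<lambda>n. H n y) \<longlonglongrightarrow> G y" if "y \<in> {a..b}" for y
    unfolding H_def G_def
  proof (rule bounded_convergence_integral[where M=M, OF _ _ _ ae])
    show "g \<in> borel_measurable (lebesgue_on {a..y})"
      by (rule measurable_restrict_mono[OF g(1)]) (use that in auto)
  qed (use hb hc that borel_measurable_continuous_lebesgue_on_Icc in auto)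
  have Hb: "\<bar>H n y\<bar> \<le> M * (b - a)" if "y \<in> {a..b}" for n y
  proof -
    have "norm (integral {a..y} (h n)) \<le> M * (y - a)"
      by (rule integral_bound) (use that hb hc in auto)
    also have "\<dots> \<le> M * (b - a)" using M0 that by (intro mult_left_mono) auto
    finally show ?thesis by (simp add: H_def)
  qed
  have HD: "(H n has_real_derivative h n x) (at x)" if "x \<in> {a<..<b}" for n x
  proof -
    have "(H n has_vector_derivative h n x) (at x within {a..b})"
      unfolding H_def using that by (intro integral_has_vector_derivative hc) auto
    then show ?thesis
      using that by (simp add: has_real_derivative_iff_has_vector_derivative at_within_Icc_at)
  qed
  have Hc: "continuous_on {a..b} (H n)" for n
    unfolding H_def by (intro indefinite_integral_continuous_1 integrable_continuous_interval hc)
  have Gc: "continuous_on {a..b} G"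
    unfolding G_def by (intro indefinite_integral_continuous_1 integrable_on_lebesgue_on_bounded[OF g])
  obtain D where D: "\<And>x. x \<in> {a..b} \<Longrightarrow> \<bar>deriv \<phi> x\<bar> \<le> D"
    using compact_imp_bounded[OF compact_continuous_image[OF \<phi>c(2) compact_Icc]]
    by (force simp: bounded_iff)
  obtain F where F: "\<And>x. x \<in> {a..b} \<Longrightarrow> \<bar>\<phi> x\<bar> \<le> F"
    using compact_imp_bounded[OF compact_continuous_image[OF \<phi>c(1) compact_Icc]]
    by (force simp: bounded_iff)
  have parts: "integral {a..b} (\<lambda>x. (K + H n x) * deriv \<phi> x) = - integral {a..b} (\<lambda>x. h n x * \<phi> x)" for n
    by (rule integral_by_parts_test[OF assms(1,2)])
      (use HD in \<open>auto intro!: continuous_intros Hc hc derivative_eq_intros\<close>)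
  have "(\<lambda>n. integral {a..b} (\<lambda>x. (K + H n x) * deriv \<phi> x)) \<longlonglongrightarrow> integral {a..b} (\<lambda>x. (K + G x) * deriv \<phi> x)"
  proof (rule bounded_convergence_integral[where M="(\<bar>K\<bar> + M * (b - a)) * D"])
    show "(\<lambda>x. (K + H n x) * deriv \<phi> x) \<in> borel_measurable (lebesgue_on {a..b})" for n
      by (intro borel_measurable_continuous_lebesgue_on_Icc continuous_intros Hc \<phi>c)
    show "(\<lambda>x. (K + G x) * deriv \<phi> x) \<in> borel_measurable (lebesgue_on {a..b})"
      by (intro borel_measurable_continuous_lebesgue_on_Icc continuous_intros Gc \<phi>c)
    show "\<bar>(K + H n x) * deriv \<phi> x\<bar> \<le> (\<bar>K\<bar> + M * (b - a)) * D" if "x \<in> {a..b}" for n x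
      unfolding abs_mult using Hb[OF that, of n] D[OF that] M0 assms(1) by (intro mult_mono) auto
    show "AE x in lebesgue_on {a..b}. (\<lambda>n. (K + H n x) * deriv \<phi> x) \<longlonglongrightarrow> (K + G x) * deriv \<phi> x"
      using Hl by (intro AE_I2 tendsto_intros) auto
  qed
  moreover have "(\<lambda>n. integral {a..b} (\<lambda>x. h n x * \<phi> x)) \<longlonglongrightarrow> integral {a..b} (\<lambda>x. g x * \<phi> x)"
  proof (rule bounded_convergence_integral[where M="M * F"])
    show "(\<lambda>x. h n x * \<phi> x) \<in> borel_measurable (lebesgue_on {a..b})" for n
      by (intro borel_measurable_continuous_lebesgue_on_Icc continuous_intros hc \<phi>c)
    show "(\<lambda>x. g x * \<phi> x) \<in> borel_measurable (lebesgue_on {a..b})"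
      by (intro borel_measurable_times g borel_measurable_continuous_lebesgue_on_Icc \<phi>c)
    show "\<bar>h n x * \<phi> x\<bar> \<le> M * F" if "x \<in> {a..b}" for n x
      unfolding abs_mult using hb[of n x] F[OF that] M0 by (intro mult_mono) auto
    show "AE x in lebesgue_on {a..b}. (\<lambda>n. h n x * \<phi> x) \<longlonglongrightarrow> g x * \<phi> x"
      using ae[of b] by (rule eventually_mono[OF _ tendsto_mult[OF _ tendsto_const]]) auto
  qed
  ultimately have "integral {a..b} (\<lambda>x. (K + G x) * deriv \<phi> x) = - integral {a..b} (\<lambda>x. g x * \<phi> x)"
    unfolding parts using LIMSEQ_unique tendsto_minus by blast
  then show ?thesis by (simp add: G_def)
qed

section \<open>From test functions to the Sobolev closure\<close>

lemma integrable_const_lebesgue_on_Ioo: "integrable (lebesgue_on {a<..<b::real}) (\<lambda>x. c :: real)"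
  unfolding integrable_lebesgue_on_Ioo_iff
  by (intro integrable_continuous_lebesgue_on continuous_intros)

lemma L2_imp_integrable:
  assumes "f \<in> L2 {a<..<b}"
  shows "integrable (lebesgue_on {a<..<b}) f"
proof (rule Bochner_Integration.integrable_bound[of _ "\<lambda>x. 1 + (f x)\<^sup>2"])
  show "integrable (lebesgue_on {a<..<b}) (\<lambda>x. 1 + (f x)\<^sup>2)"
    using assms by (intro Bochner_Integration.integrable_add integrable_const_lebesgue_on_Ioo) (auto simp: L2_def)
  have "\<bar>f x\<bar> \<le> 1 + (f x)\<^sup>2" for x
    using zero_le_power2[of "\<bar>f x\<bar> - 1"] by (simp add: power2_diff)
  then show "AE x in lebesgue_on {a<..<b}. norm (f x) \<le> norm (1 + (f x)\<^sup>2)"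
    by (intro AE_I2) auto
qed (use assms in \<open>auto simp: L2_def\<close>)

lemma L2_diff:
  assumes "f \<in> L2 S" "h \<in> L2 S"
  shows "(\<lambda>x. f x - h x) \<in> L2 S"
proof -
  have m: "f \<in> borel_measurable (lebesgue_on S)" "h \<in> borel_measurable (lebesgue_on S)"
    and i: "integrable (lebesgue_on S) (\<lambda>x. (f x)\<^sup>2)" "integrable (lebesgue_on S) (\<lambda>x. (h x)\<^sup>2)"
    using assms by (simp_all add: L2_def)
  have "(f x - h x)\<^sup>2 \<le> 2 * (f x)\<^sup>2 + 2 * (h x)\<^sup>2" for x
    using zero_le_power2[of "f x + h x"] by (simp add: power2_sum power2_diff)
  then have le: "norm ((f x - h x)\<^sup>2) \<le> norm (2 * (f x)\<^sup>2 + 2 * (h x)\<^sup>2)" for x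
    by (simp add: abs_of_nonneg)
  have "integrable (lebesgue_on S) (\<lambda>x. (f x - h x)\<^sup>2)"
  proof (rule Bochner_Integration.integrable_bound)
    show "integrable (lebesgue_on S) (\<lambda>x. 2 * (f x)\<^sup>2 + 2 * (h x)\<^sup>2)" using i by simp
    show "(\<lambda>x. (f x - h x)\<^sup>2) \<in> borel_measurable (lebesgue_on S)" using m by measurable
  qed (use le in auto)
  then show ?thesis using m by (simp add: L2_def)
qed

text \<open>Young's inequality \<open>|f| \<le> \<epsilon>/2 + f^2/(2*\<epsilon>)\<close> takes the
  place of Cauchy-Schwarz; what matters is that the bound is linear in
  \<open>\<epsilon>\<close>.\<close>

lemma integral_abs_le_if_L2_small:
  assumes "f \<in> L2 {a<..<b}" "(LINT x|lebesgue_on {a<..<b}. (f x)\<^sup>2) \<le> \<epsilon>\<^sup>2" "\<epsilon> > 0" "a \<le> b"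
  shows "(LINT x|lebesgue_on {a<..<b}. \<bar>f x\<bar>) \<le> \<epsilon> * (b - a + 1) / 2"
proof -
  have f2: "integrable (lebesgue_on {a<..<b}) (\<lambda>x. (f x)\<^sup>2)" using assms by (auto simp: L2_def)
  have "\<bar>f x\<bar> \<le> \<epsilon> / 2 + (f x)\<^sup>2 / (2 * \<epsilon>)" for x
    using zero_le_power2[of "\<bar>f x\<bar> - \<epsilon>"] assms(3) by (simp add: power2_diff field_simps power2_eq_square)
  then have "(LINT x|lebesgue_on {a<..<b}. \<bar>f x\<bar>) \<le> (LINT x|lebesgue_on {a<..<b}. \<epsilon> / 2 + (f x)\<^sup>2 / (2 * \<epsilon>))"
    using f2 L2_imp_integrable[OF assms(1)]
    by (intro integral_mono Bochner_Integration.integrable_add integrable_const_lebesgue_on_Ioo) auto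
  also have "\<dots> = (LINT x|lebesgue_on {a<..<b}. \<epsilon> / 2) + (LINT x|lebesgue_on {a<..<b}. (f x)\<^sup>2) / (2 * \<epsilon>)"
    using f2 by (subst Bochner_Integration.integral_add) (auto intro: integrable_const_lebesgue_on_Ioo)
  also have "(LINT x|lebesgue_on {a<..<b}. \<epsilon> / 2) = \<epsilon> / 2 * (b - a)"
    using LINT_Ioo_eq_integral[OF integrable_const_lebesgue_on_Ioo, of a b "\<epsilon> / 2"] assms(4) by simp
  also have "\<epsilon> / 2 * (b - a) + (LINT x|lebesgue_on {a<..<b}. (f x)\<^sup>2) / (2 * \<epsilon>) \<le> \<epsilon> / 2 * (b - a) + \<epsilon>\<^sup>2 / (2 * \<epsilon>)"
    using assms by (intro add_left_mono divide_right_mono) auto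
  also have "\<dots> = \<epsilon> * (b - a + 1) / 2" using assms(3) by (simp add: field_simps power2_eq_square)
  finally show ?thesis .
qed

lemma integrable_bounded_mult:
  fixes f g :: "real \<Rightarrow> real"
  assumes "integrable (lebesgue_on {a<..<b}) f" "g \<in> borel_measurable (lebesgue_on {a<..<b})"
    and "\<And>x. x \<in> {a<..<b} \<Longrightarrow> \<bar>g x\<bar> \<le> C"
  shows "integrable (lebesgue_on {a<..<b}) (\<lambda>x. g x * f x)"
    and "\<bar>LINT x|lebesgue_on {a<..<b}. g x * f x\<bar> \<le> C * (LINT x|lebesgue_on {a<..<b}. \<bar>f x\<bar>)"
proof -
  have Cf: "integrable (lebesgue_on {a<..<b}) (\<lambda>x. C * \<bar>f x\<bar>)" using assms(1) by simp
  have le: "\<bar>g x * f x\<bar> \<le> C * \<bar>f x\<bar>" if "x \<in> {a<..<b}" for x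
    using mult_right_mono[OF assms(3)[OF that], of "\<bar>f x\<bar>"] by (simp add: abs_mult)
  have "norm (g x * f x) \<le> norm (C * \<bar>f x\<bar>)" if "x \<in> {a<..<b}" for x
    using le[OF that] by simp
  then show i: "integrable (lebesgue_on {a<..<b}) (\<lambda>x. g x * f x)"
    using assms by (intro Bochner_Integration.integrable_bound[OF Cf] borel_measurable_times AE_I2) auto
  have "\<bar>LINT x|lebesgue_on {a<..<b}. g x * f x\<bar> \<le> (LINT x|lebesgue_on {a<..<b}. \<bar>g x * f x\<bar>)"
    by (rule integral_abs_bound)
  also have "\<dots> \<le> (LINT x|lebesgue_on {a<..<b}. C * \<bar>f x\<bar>)"
    using i le by (intro integral_mono Cf) auto
  finally show "\<bar>LINT x|lebesgue_on {a<..<b}. g x * f x\<bar> \<le> C * (LINT x|lebesgue_on {a<..<b}. \<bar>f x\<bar>)"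
    by simp
qed

text \<open>Membership in \<open>H1\<close> provides some square integrable weak derivative; almost
  everywhere uniqueness carries square integrability over to the chosen one.\<close>

lemma H1_weak_deriv:
  assumes "a < b" "u \<in> H1 a b"
  shows "has_weak_deriv a b u (weak_deriv a b u)" "weak_deriv a b u \<in> L2 {a<..<b}" "u \<in> L2 {a<..<b}"
proof -
  obtain g where g: "g \<in> L2 {a<..<b}" "has_weak_deriv a b u g" and u: "u \<in> L2 {a<..<b}"
    using assms(2) by (auto simp: H1_def)
  show "has_weak_deriv a b u (weak_deriv a b u)" by (rule has_weak_deriv_weak_deriv[OF g(2)])
  show "u \<in> L2 {a<..<b}" by fact
  have ae: "AE x in lebesgue_on {a<..<b}. g x = weak_deriv a b u x"
    using weak_deriv_AE_eq[OF assms(1) g(2)] by (rule eventually_mono) simp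
  then have ae2: "AE x in lebesgue_on {a<..<b}. (g x)\<^sup>2 = (weak_deriv a b u x)\<^sup>2"
    by (rule eventually_mono) simp
  have m: "weak_deriv a b u \<in> borel_measurable (lebesgue_on {a<..<b})"
    by (rule borel_measurable_lebesgue_on_AE[OF _ _ ae]) (use g in \<open>auto simp: L2_def\<close>)
  have "integrable (lebesgue_on {a<..<b}) (\<lambda>x. (weak_deriv a b u x)\<^sup>2)"
    by (rule integrable_cong_AE_imp[OF _ _ ae2]) (use m g in \<open>auto simp: L2_def\<close>)
  with m show "weak_deriv a b u \<in> L2 {a<..<b}" by (auto simp: L2_def)
qed

lemma has_weak_deriv_diff:
  assumes "a < b" "has_weak_deriv a b u g" "has_weak_deriv a b v h"
  shows "has_weak_deriv a b (\<lambda>x. u x - v x) (\<lambda>x. g x - h x)"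
proof -
  have li: "locally_integrable {a<..<b} u" "locally_integrable {a<..<b} g"
    "locally_integrable {a<..<b} v" "locally_integrable {a<..<b} h"
    using assms by (auto simp: has_weak_deriv_def)
  have "(LINT x|lebesgue_on {a<..<b}. (u x - v x) * deriv \<phi> x) = - (LINT x|lebesgue_on {a<..<b}. (g x - h x) * \<phi> x)"
    if t: "\<phi> \<in> test_functions a b" for \<phi>
  proof -
    obtain c d where cd: "smooth \<phi>" "a < c" "c < d" "d < b" "\<And>x. x \<notin> {c..d} \<Longrightarrow> \<phi> x = 0"
      using test_functionsE[OF t assms(1)] by metis
    \<comment> \<open>\<open>\<phi>\<close> vanishes on the open complement of
      \<open>{c..d}\<close>. Hence \<open>deriv \<phi>\<close> is a test function too, and the
      integrals of the difference may be split.\<close>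
    have "deriv \<phi> x = 0" if "x \<notin> {c..d}" for x
    proof -
      have "((\<lambda>x. 0) has_real_derivative 0) (at x)" by simp
      then have "(\<phi> has_real_derivative 0) (at x)"
        by (rule has_field_derivative_transform_within_open[where S="- {c..d}"]) (use that cd(5) in auto)
      then show ?thesis by (rule DERIV_imp_deriv)
    qed
    then have t': "deriv \<phi> \<in> test_functions a b"
      using cd smooth_deriv by (intro test_functionsI[of _ _ c d]) auto
    show ?thesis
      using assms(2,3) t
      by (simp add: left_diff_distrib Bochner_Integration.integral_diff has_weak_deriv_def
          locally_integrable_mult_test[OF _ t \<open>a < b\<close>] locally_integrable_mult_test[OF _ t' \<open>a < b\<close>])
  qed
  moreover have "locally_integrable {a<..<b} (\<lambda>x. u x - v x)" "locally_integrable {a<..<b} (\<lambda>x. g x - h x)"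
    using li by (auto simp: locally_integrable_def)
  ultimately show ?thesis by (simp add: has_weak_deriv_def)
qed

text \<open>On test functions the identity is integration by parts. Its left-hand side
  \<open>X\<close> is linear in \<open>u\<close> and, as \<open>\<Phi>\<close> and \<open>g\<close>
  are bounded, dominated by the integrals of \<open>|u|\<close> and of its weak derivative's
  absolute value, hence by the Sobolev norm; so the identity extends to the closure.\<close>

lemma weak_equation_H10:
  assumes ab: "a < b" and u: "u \<in> H10 a b"
    and g: "g \<in> borel_measurable (lebesgue_on {a..b})" "\<And>x. x \<in> {a..b} \<Longrightarrow> \<bar>g x\<bar> \<le> M"
    and \<Phi>: "\<And>x. x \<in> {a..b} \<Longrightarrow> \<Phi> x = K + integral {a..x} g"
  shows "integrable (lebesgue_on {a<..<b}) (\<lambda>x. \<Phi> x * weak_deriv a b u x)" (is ?i1)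
    and "integrable (lebesgue_on {a<..<b}) (\<lambda>x. g x * u x)" (is ?i2)
    and "(LINT x|lebesgue_on {a<..<b}. \<Phi> x * weak_deriv a b u x) + (LINT x|lebesgue_on {a<..<b}. g x * u x) = 0"
proof -
  define d where "d = weak_deriv a b u"
  have uH: "u \<in> H1 a b" using u by (simp add: H10_def)
  note du = H1_weak_deriv[OF ab uH, folded d_def]
  have "continuous_on {a..b} (\<lambda>x. K + integral {a..x} g)"
    by (intro continuous_intros indefinite_integral_continuous_1 integrable_on_lebesgue_on_bounded[OF g])
  then have \<Phi>c: "continuous_on {a..b} \<Phi>" by (subst continuous_on_cong[OF refl \<Phi>])
  obtain C where C: "\<And>x. x \<in> {a..b} \<Longrightarrow> \<bar>\<Phi> x\<bar> \<le> C"
    using compact_imp_bounded[OF compact_continuous_image[OF \<Phi>c compact_Icc]]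
    by (force simp: bounded_iff)
  have M0: "M \<ge> 0" using g(2)[of a] ab by force
  have C0: "C \<ge> 0" using C[of a] ab by force
  have gm: "g \<in> borel_measurable (lebesgue_on {a<..<b})"
    by (rule measurable_restrict_mono[OF g(1)]) auto
  have \<Phi>m: "\<Phi> \<in> borel_measurable (lebesgue_on {a<..<b})"
    by (rule measurable_restrict_mono[OF borel_measurable_continuous_lebesgue_on_Icc[OF \<Phi>c]]) auto
  have \<Phi>i: "integrable (lebesgue_on {a<..<b}) (\<lambda>x. \<Phi> x * f x)"
    "\<bar>LINT x|lebesgue_on {a<..<b}. \<Phi> x * f x\<bar> \<le> C * (LINT x|lebesgue_on {a<..<b}. \<bar>f x\<bar>)"
    if "integrable (lebesgue_on {a<..<b}) f" for f
    using integrable_bounded_mult[OF that \<Phi>m, of C] C by auto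
  have gi: "integrable (lebesgue_on {a<..<b}) (\<lambda>x. g x * f x)"
    "\<bar>LINT x|lebesgue_on {a<..<b}. g x * f x\<bar> \<le> M * (LINT x|lebesgue_on {a<..<b}. \<bar>f x\<bar>)"
    if "integrable (lebesgue_on {a<..<b}) f" for f
    using integrable_bounded_mult[OF that gm, of M] g(2) by auto
  note ui = L2_imp_integrable[OF du(3)] and di = L2_imp_integrable[OF du(2)]
  show ?i1 using \<Phi>i(1)[OF di] by (simp add: d_def)
  show ?i2 using gi(1)[OF ui] .
  define X where "X = (LINT x|lebesgue_on {a<..<b}. \<Phi> x * d x) + (LINT x|lebesgue_on {a<..<b}. g x * u x)"
  have *: "\<bar>X\<bar> \<le> (C + M) * ((b - a + 1) / 2) * \<epsilon>" if e: "\<epsilon> > 0" for \<epsilon>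
  proof -
    obtain \<phi> where t: "\<phi> \<in> test_functions a b" and lt: "H1_norm a b (\<lambda>x. u x - \<phi> x) < \<epsilon>"
      using u e unfolding H10_def by blast
    have \<phi>c: "continuous_on S \<phi>" "continuous_on S (deriv \<phi>)" for S
      using test_function_continuous[OF ab t] test_function_deriv_continuous[OF ab t] by auto
    have \<phi>i: "integrable (lebesgue_on {a<..<b}) \<phi>" "integrable (lebesgue_on {a<..<b}) (deriv \<phi>)"
      unfolding integrable_lebesgue_on_Ioo_iff by (intro integrable_continuous_lebesgue_on \<phi>c)+
    have z: "(LINT x|lebesgue_on {a<..<b}. \<Phi> x * deriv \<phi> x) + (LINT x|lebesgue_on {a<..<b}. g x * \<phi> x) = 0"
    proof -
      have "integral {a..b} (\<lambda>x. \<Phi> x * deriv \<phi> x) = integral {a..b} (\<lambda>x. (K + integral {a..x} g) * deriv \<phi> x)"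
        by (rule integral_cong) (simp add: \<Phi>)
      then show ?thesis
        using integral_by_parts_indefinite_integral[OF ab t g, of K]
        by (simp add: LINT_Ioo_eq_integral \<Phi>i(1)[OF \<phi>i(2)] gi(1)[OF \<phi>i(1)])
    qed
    define e where "e x = u x - \<phi> x" for x
    define e' where "e' x = d x - deriv \<phi> x" for x
    have ei: "integrable (lebesgue_on {a<..<b}) e" "integrable (lebesgue_on {a<..<b}) e'"
      unfolding e_def[abs_def] e'_def[abs_def] using ui di \<phi>i by auto
    have "has_weak_deriv a b \<phi> (deriv \<phi>)"
      by (rule has_weak_deriv_C1[OF ab \<phi>c test_function_deriv[OF ab t]])
    then have "has_weak_deriv a b e e'"
      unfolding e_def[abs_def] e'_def[abs_def] by (rule has_weak_deriv_diff[OF ab du(1)])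
    note wd = weak_deriv_AE_eq[OF ab this]
    have eL: "e \<in> L2 {a<..<b}" "e' \<in> L2 {a<..<b}"
      unfolding e_def[abs_def] e'_def[abs_def] by (intro L2_diff du L2_continuous \<phi>c)+
    have m': "weak_deriv a b e \<in> borel_measurable (lebesgue_on {a<..<b})"
      by (rule borel_measurable_lebesgue_on_AE[where f=e']) (use eL wd in \<open>auto simp: L2_def\<close>)
    have "(LINT x|lebesgue_on {a<..<b}. (weak_deriv a b e x)\<^sup>2) = (LINT x|lebesgue_on {a<..<b}. (e' x)\<^sup>2)"
      by (rule integral_cong_AE) (use eL wd m' in \<open>auto simp: L2_def\<close>)
    then have "sqrt ((LINT x|lebesgue_on {a<..<b}. (e x)\<^sup>2) + (LINT x|lebesgue_on {a<..<b}. (e' x)\<^sup>2)) < \<epsilon>"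
      using lt by (simp add: H1_norm_def e_def[symmetric])
    then have le: "(LINT x|lebesgue_on {a<..<b}. (e x)\<^sup>2) + (LINT x|lebesgue_on {a<..<b}. (e' x)\<^sup>2) < \<epsilon>\<^sup>2"
      using real_le_rsqrt by (meson not_le)
    have n: "(LINT x|lebesgue_on {a<..<b}. (e x)\<^sup>2) \<ge> 0" "(LINT x|lebesgue_on {a<..<b}. (e' x)\<^sup>2) \<ge> 0"
      by (auto intro: integral_nonneg_AE)
    then have le2: "(LINT x|lebesgue_on {a<..<b}. (e x)\<^sup>2) \<le> \<epsilon>\<^sup>2" "(LINT x|lebesgue_on {a<..<b}. (e' x)\<^sup>2) \<le> \<epsilon>\<^sup>2"
      using le by linarith+
    have "X = (LINT x|lebesgue_on {a<..<b}. \<Phi> x * e' x) + (LINT x|lebesgue_on {a<..<b}. g x * e x)"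
      using z by (simp add: X_def e_def e'_def right_diff_distrib Bochner_Integration.integral_diff \<Phi>i(1) gi(1) di ui \<phi>i)
    also have "\<bar>\<dots>\<bar> \<le> C * (LINT x|lebesgue_on {a<..<b}. \<bar>e' x\<bar>) + M * (LINT x|lebesgue_on {a<..<b}. \<bar>e x\<bar>)"
      using \<Phi>i(2)[OF ei(2)] gi(2)[OF ei(1)] by linarith
    also have "\<dots> \<le> C * (\<epsilon> * (b - a + 1) / 2) + M * (\<epsilon> * (b - a + 1) / 2)"
      using le2 e ab by (intro add_mono mult_left_mono integral_abs_le_if_L2_small eL C0 M0) auto
    also have "\<dots> = (C + M) * ((b - a + 1) / 2) * \<epsilon>" by (simp add: field_simps)
    finally show ?thesis .
  qed
  have "X = 0"
  proof (rule ccontr)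
    assume "X \<noteq> 0"
    \<comment> \<open>The summand 1 makes \<open>B\<close> positive and larger than the constant in
      the estimate, so \<open>\<epsilon> = |X| / B\<close> gives \<open>|X| < |X|\<close>.\<close>
    define B where "B = (C + M) * ((b - a + 1) / 2) + 1"
    have B: "B > 0" unfolding B_def using C0 M0 ab by (auto intro!: add_nonneg_pos mult_nonneg_nonneg)
    have "\<bar>X\<bar> \<le> (B - 1) * (\<bar>X\<bar> / B)" using *[of "\<bar>X\<bar> / B"] B \<open>X \<noteq> 0\<close> by (simp add: B_def)
    then show False using B \<open>X \<noteq> 0\<close> by (simp add: field_simps)
  qed
  then show "(LINT x|lebesgue_on {a<..<b}. \<Phi> x * weak_deriv a b u x) + (LINT x|lebesgue_on {a<..<b}. g x * u x) = 0"
    by (simp add: X_def d_def)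
qed

subsection \<open>The first-order boundary value problem\<close>

lemma continuous_on_slice:
  assumes "continuous_on (UNIV \<times> S) (\<lambda>(k, x). f k x)"
  shows "continuous_on S (f k)"
proof -
  have "continuous_on S (\<lambda>x. (k, x))" by (intro continuous_intros)
  from continuous_on_compose2[OF assms this] show ?thesis by auto
qed

text \<open>Rescaling to \<open>{0..1}\<close> moves the variable endpoint into the integrand, where
  continuity of parameter integrals applies.\<close>

lemma indefinite_integral_jointly_continuous:
  fixes g :: "real \<Rightarrow> real \<Rightarrow> real"
  assumes "a \<le> b" "continuous_on (UNIV \<times> {a..b}) (\<lambda>(k, t). g k t)"
  shows "continuous_on (UNIV \<times> {a..b}) (\<lambda>(k, x). integral {a..x} (g k))"
proof -
  have gc: "continuous_on {a..b} (g k)" for k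
    by (rule continuous_on_slice[OF assms(2)])
  have m: "a + t * (x - a) \<in> {a..b}" if "x \<in> {a..b}" "t \<in> {0..1}" for x t
  proof -
    have "0 \<le> t * (x - a)" "t * (x - a) \<le> 1 * (x - a)"
      using that mult_right_mono[of t 1 "x - a"] by auto
    then show ?thesis using that by auto
  qed
  have eq: "integral {a..x} (g k) = integral {0..1} (\<lambda>t. (x - a) * g k (a + t * (x - a)))"
    if "x \<in> {a..b}" for x k
  proof -
    have "((\<lambda>t. (x - a) *\<^sub>R g k (a + t * (x - a))) has_integral (integral {a + 0 * (x - a)..a + 1 * (x - a)} (g k))) {0..1}"
      using that assms(1) m by (intro has_integral_substitution[where c=a and d=b] gc)
        (auto intro!: derivative_eq_intros)
    then show ?thesis by (auto dest: integral_unique)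
  qed
  have "continuous_on (UNIV \<times> {a..b}) (\<lambda>z. integral (cbox 0 1) (\<lambda>t. (snd z - a) * g (fst z) (a + t * (snd z - a))))"
  proof (rule integral_continuous_on_param)
    have "continuous_on ((UNIV \<times> {a..b}) \<times> cbox 0 1)
       (\<lambda>z. (snd (fst z) - a) * (case (fst (fst z), a + snd z * (snd (fst z) - a)) of (k, t) \<Rightarrow> g k t))"
      by (intro continuous_intros continuous_on_compose2[OF assms(2)]) (use m in auto)
    then show "continuous_on ((UNIV \<times> {a..b}) \<times> cbox 0 1)
       (\<lambda>(z, t). (snd z - a) * g (fst z) (a + t * (snd z - a)))"
      by (simp add: case_prod_beta)
  qed
  then have "continuous_on (UNIV \<times> {a..b}) (\<lambda>z. integral {a..snd z} (g (fst z)))"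
    by (rule continuous_on_eq) (auto simp: eq)
  then show ?thesis by (simp add: case_prod_beta)
qed

text \<open>Intended reading: \<open>p\<close> is the weight \<open>r^(n-1)\<close>,
  \<open>lam\<close> is \<open>J / \<tau>\<close>, \<open>G\<close> is the truncated inverse of the
  enthalpy. \<open>D\<close> is the primitive of the datum \<open>d\<close>, which is continuous
  even when \<open>d\<close> is merely integrable.\<close>

locale flux_problem =
  fixes a b lam l J :: real and p D G :: "real \<Rightarrow> real"
  assumes ab: "a < b" and lam: "lam \<ge> 0" and l: "0 < l"
    and p: "continuous_on {a..b} p" "\<And>x. x \<in> {a..b} \<Longrightarrow> 0 < p x"
    and D: "continuous_on {a..b} D"
    and G: "continuous_on UNIV G" "\<And>w. l \<le> G w" "\<And>w. G w \<le> J"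
begin

text \<open>The integrated equation solved for \<open>w'\<close>, with \<open>u\<close> in place of
  the unknown on the right. The constant \<open>k\<close> is the total flux at \<open>a\<close> when
  \<open>D a = 0\<close>.\<close>

definition slope :: "real \<Rightarrow> (real \<Rightarrow> real) \<Rightarrow> real \<Rightarrow> real" where
  "slope k u s = (k + integral {a..s} (\<lambda>t. G (u t)) - D s) / p s - lam / G (u s)"

text \<open>The method of steps as an iteration: the \<open>n\<close>-th iterate solves the delay
  equation on \<open>{a..a + n * \<delta>}\<close>. The \<open>max a\<close> continues a function to
  the left of \<open>a\<close> by its value at \<open>a\<close>.\<close>

fun delayed :: "real \<Rightarrow> nat \<Rightarrow> real \<Rightarrow> real \<Rightarrow> real" where
  "delayed \<delta> 0 k x = 0"
| "delayed \<delta> (Suc n) k x = integral {a..x} (slope k (\<lambda>t. delayed \<delta> n k (max a (t - \<delta>))))"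

lemma G_pos: "G w > 0"
  using G(2)[of w] l by linarith

lemma slope_jointly_continuous:
  assumes "continuous_on (UNIV \<times> {a..b}) (\<lambda>(k, x). u k x)"
  shows "continuous_on (UNIV \<times> {a..b}) (\<lambda>(k, x). slope k (u k) x)"
proof -
  have Gu: "continuous_on (UNIV \<times> {a..b}) (\<lambda>(k, x). G (u k x))"
    using continuous_on_compose2[OF G(1) assms] by (simp add: case_prod_beta)
  have "continuous_on (UNIV \<times> {a..b}) (\<lambda>z. (fst z + (case z of (k, x) \<Rightarrow> integral {a..x} (\<lambda>t. G (u k t))) - D (snd z)) / p (snd z)
     - lam / (case z of (k, x) \<Rightarrow> G (u k x)))"
  proof (intro continuous_intros)
    show "continuous_on (UNIV \<times> {a..b}) (\<lambda>(k, x). integral {a..x} (\<lambda>t. G (u k t)))"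
      by (rule indefinite_integral_jointly_continuous[OF less_imp_le[OF ab] Gu])
    show "continuous_on (UNIV \<times> {a..b}) (\<lambda>z. D (snd z))" "continuous_on (UNIV \<times> {a..b}) (\<lambda>z. p (snd z))"
      by (intro continuous_on_compose2[OF D] continuous_on_compose2[OF p(1)] continuous_intros; auto)+
    show "\<forall>z\<in>UNIV \<times> {a..b}. p (snd z) \<noteq> 0" using p(2) by fastforce
    show "\<forall>z\<in>UNIV \<times> {a..b}. (case z of (k, x) \<Rightarrow> G (u k x)) \<noteq> 0" using G_pos by (auto simp: less_imp_neq[symmetric] neq_iff)
  qed (rule Gu)
  then show ?thesis by (simp add: slope_def case_prod_beta)
qed

lemma slope_continuous:
  assumes "continuous_on {a..b} u"
  shows "continuous_on {a..b} (slope k u)"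
proof -
  have "continuous_on (UNIV \<times> {a..b}) (\<lambda>(k :: real, x). u x)"
    unfolding case_prod_beta
    by (rule continuous_on_compose2[OF assms continuous_on_snd[OF continuous_on_id]]) auto
  from continuous_on_slice[OF slope_jointly_continuous[OF this]] show ?thesis .
qed

text \<open>Continuity in \<open>k\<close> at the endpoint \<open>b\<close> is what the intermediate
  value theorem will use; joint continuity is the form that survives the induction.\<close>

lemma delayed_jointly_continuous:
  assumes "\<delta> \<ge> 0"
  shows "continuous_on (UNIV \<times> {a..b}) (\<lambda>(k, x). delayed \<delta> n k x)"
proof (induction n)
  case (Suc n)
  have "continuous_on (UNIV \<times> {a..b}) (\<lambda>z. case (fst z, max a (snd z - \<delta>)) of (k, x) \<Rightarrow> delayed \<delta> n k x)"
    by (intro continuous_on_compose2[OF Suc] continuous_intros) (use ab assms in auto)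
  then have "continuous_on (UNIV \<times> {a..b}) (\<lambda>(k, x). delayed \<delta> n k (max a (x - \<delta>)))"
    by (simp add: case_prod_beta)
  from indefinite_integral_jointly_continuous[OF less_imp_le[OF ab] slope_jointly_continuous[OF this]]
  show ?case by simp
qed (simp add: case_prod_beta)

lemma slope_cong:
  assumes "\<And>t. t \<in> {a..s} \<Longrightarrow> u t = v t" "a \<le> s"
  shows "slope k u s = slope k v s"
proof -
  have "integral {a..s} (\<lambda>t. G (u t)) = integral {a..s} (\<lambda>t. G (v t))"
    by (rule integral_cong) (simp add: assms)
  then show ?thesis using assms by (simp add: slope_def)
qed

text \<open>The slope up to \<open>x\<close> looks at the previous iterate only up to
  \<open>x - \<delta>\<close>, so each iteration settles one more interval of length
  \<open>\<delta>\<close>.\<close>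

lemma delayed_stationary:
  assumes "\<delta> \<ge> 0" "a \<le> x" "x \<le> a + real n * \<delta>"
  shows "delayed \<delta> (Suc n) k x = delayed \<delta> n k x"
  using assms(2,3)
proof (induction n arbitrary: x)
  case (Suc n)
  have "integral {a..x} (slope k (\<lambda>t. delayed \<delta> (Suc n) k (max a (t - \<delta>)))) =
    integral {a..x} (slope k (\<lambda>t. delayed \<delta> n k (max a (t - \<delta>))))"
  proof (rule integral_cong, rule slope_cong)
    fix s t assume "s \<in> {a..x}" "t \<in> {a..s}"
    then have "max a (t - \<delta>) \<le> a + real n * \<delta>" using Suc.prems assms(1) by (auto simp: algebra_simps)
    then show "delayed \<delta> (Suc n) k (max a (t - \<delta>)) = delayed \<delta> n k (max a (t - \<delta>))"
      by (intro Suc.IH) auto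
  qed auto
  then show ?case by simp
qed simp

lemma integral_G_bounds:
  assumes "continuous_on {a..b} u" "s \<in> {a..b}"
  shows "0 \<le> integral {a..s} (\<lambda>t. G (u t))" "integral {a..s} (\<lambda>t. G (u t)) \<le> J * (b - a)"
proof -
  have "continuous_on {a..b} (\<lambda>t. G (u t))" by (rule continuous_on_compose2[OF G(1) assms(1)]) auto
  then have i: "(\<lambda>t. G (u t)) integrable_on {a..s}"
    using assms(2) by (intro integrable_continuous_interval) (auto intro: continuous_on_subset)
  then show "0 \<le> integral {a..s} (\<lambda>t. G (u t))"
    using G_pos by (intro integral_nonneg) (auto intro: less_imp_le)
  have "J \<ge> 0" using G(2,3)[of 0] l by linarith
  have "integral {a..s} (\<lambda>t. G (u t)) \<le> integral {a..s} (\<lambda>t. J)"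
    by (intro integral_le i) (auto simp: G)
  also have "\<dots> \<le> J * (b - a)" using assms(2) \<open>J \<ge> 0\<close> by (auto simp: mult.commute intro!: mult_left_mono)
  finally show "integral {a..s} (\<lambda>t. G (u t)) \<le> J * (b - a)" .
qed

text \<open>All terms other than \<open>k\<close> are bounded uniformly in \<open>u\<close>, since
  \<open>G\<close> takes values between \<open>l\<close> and \<open>J\<close>. Hence a large
  \<open>|k|\<close> dictates the sign of the slope, and the bounds apply to every delay at
  once.\<close>

lemma slope_bounds:
  obtains R M where "R > 0"
    "\<And>u s. continuous_on {a..b} u \<Longrightarrow> s \<in> {a..b} \<Longrightarrow> slope R u s \<ge> 0"
    "\<And>u s. continuous_on {a..b} u \<Longrightarrow> s \<in> {a..b} \<Longrightarrow> slope (- R) u s \<le> 0"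
    "\<And>k u s. \<bar>k\<bar> \<le> R \<Longrightarrow> continuous_on {a..b} u \<Longrightarrow> s \<in> {a..b} \<Longrightarrow> \<bar>slope k u s\<bar> \<le> M"
proof -
  obtain x0 where x0: "x0 \<in> {a..b}" "\<And>x. x \<in> {a..b} \<Longrightarrow> p x0 \<le> p x"
    using continuous_attains_inf[OF compact_Icc _ p(1)] ab by auto
  obtain x1 where x1: "x1 \<in> {a..b}" "\<And>x. x \<in> {a..b} \<Longrightarrow> p x \<le> p x1"
    using continuous_attains_sup[OF compact_Icc _ p(1)] ab by auto
  obtain Dm where Dm: "\<And>x. x \<in> {a..b} \<Longrightarrow> \<bar>D x\<bar> \<le> Dm"
    using compact_imp_bounded[OF compact_continuous_image[OF D compact_Icc]]
    by (force simp: bounded_iff)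
  have Dm0: "Dm \<ge> 0" using Dm[of a] ab by force
  have JL: "J * (b - a) \<ge> 0" using G(2,3)[of 0] l ab by (intro mult_nonneg_nonneg) linarith+
  have p0: "p x0 > 0" using p(2)[OF x0(1)] .
  have lG: "0 \<le> lam / G w" "lam / G w \<le> lam / l" for w
    using lam l G(2)[of w] G_pos[of w] by (auto intro!: divide_left_mono)
  have Q0: "lam / l * p x1 \<ge> 0" using lam l p(2)[OF x1(1)] by simp
  \<comment> \<open>The summands dominate in turn \<open>D\<close>, the term \<open>lam / G\<close>
    multiplied by \<open>p\<close>, and the integral of \<open>G\<close>; the 1 makes
    \<open>R\<close> positive.\<close>
  define R where "R = Dm + lam / l * p x1 + J * (b - a) + 1"
  show thesis
  proof
    show "R > 0" using Dm0 JL Q0 by (simp add: R_def)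
    fix u :: "real \<Rightarrow> real" and s assume u: "continuous_on {a..b} u" and s: "s \<in> {a..b}"
    have I: "0 \<le> integral {a..s} (\<lambda>t. G (u t))" "integral {a..s} (\<lambda>t. G (u t)) \<le> J * (b - a)"
      using integral_G_bounds[of u s] u s by auto
    note ps = p(2)[OF s] and Ds = Dm[OF s]
    have "lam / l * p s \<le> lam / l * p x1"
      using lam l x1(2)[OF s] by (intro mult_left_mono) auto
    then have "lam / l * p s \<le> R + integral {a..s} (\<lambda>t. G (u t)) - D s"
      using I Ds JL unfolding R_def by linarith
    then have "lam / l \<le> (R + integral {a..s} (\<lambda>t. G (u t)) - D s) / p s"
      using ps by (simp add: pos_le_divide_eq)
    then show "slope R u s \<ge> 0" using lG[of "u s"] by (simp add: slope_def)
    have "- R + integral {a..s} (\<lambda>t. G (u t)) - D s \<le> 0"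
      using I Ds JL Q0 unfolding R_def by linarith
    then have "(- R + integral {a..s} (\<lambda>t. G (u t)) - D s) / p s \<le> 0"
      using ps by (simp add: divide_nonpos_pos)
    then show "slope (- R) u s \<le> 0" using lG[of "u s"] by (simp add: slope_def)
    fix k assume k: "\<bar>k\<bar> \<le> R"
    have "\<bar>(k + integral {a..s} (\<lambda>t. G (u t)) - D s) / p s\<bar> \<le> (R + J * (b - a) + Dm) / p x0"
      unfolding abs_divide using I Ds k ps p0 x0(2)[OF s] by (intro frac_le) auto
    then show "\<bar>slope k u s\<bar> \<le> (R + J * (b - a) + Dm) / p x0 + lam / l"
      using lG[of "u s"] unfolding slope_def by linarith
  qed
qed

text \<open>Shooting in \<open>k\<close>: at \<open>k = R\<close> the solution is nondecreasing and
  at \<open>k = - R\<close> nonincreasing, both from the value 0, so the value at \<open>b\<close>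
  changes sign.\<close>

lemma delay_solution:
  assumes "\<delta> > 0" "R > 0"
    and R: "\<And>u s. continuous_on {a..b} u \<Longrightarrow> s \<in> {a..b} \<Longrightarrow> slope R u s \<ge> 0"
      "\<And>u s. continuous_on {a..b} u \<Longrightarrow> s \<in> {a..b} \<Longrightarrow> slope (- R) u s \<le> 0"
  obtains k w where "\<bar>k\<bar> \<le> R" "continuous_on {a..b} w" "w b = 0"
    "\<And>x. x \<in> {a..b} \<Longrightarrow> w x = integral {a..x} (slope k (\<lambda>t. w (max a (t - \<delta>))))"
proof -
  \<comment> \<open>\<open>N\<close> delays cover the interval, so the \<open>N\<close>-th iterate
    is a fixed point of the iteration on all of \<open>{a..b}\<close>.\<close>
  obtain N where N: "b - a \<le> real N * \<delta>"
    using reals_Archimedean3[OF assms(1)] less_imp_le by blast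
  define w where "w k = delayed \<delta> N k" for k
  have jc: "continuous_on (UNIV \<times> {a..b}) (\<lambda>(k, x). w k x)"
    unfolding w_def using assms(1) by (intro delayed_jointly_continuous) auto
  have wc: "continuous_on {a..b} (w k)" for k
    by (rule continuous_on_slice[OF jc])
  have uc: "continuous_on {a..b} (\<lambda>t. w k (max a (t - \<delta>)))" for k
    by (rule continuous_on_compose2[OF wc]) (use assms(1) ab in \<open>auto intro!: continuous_intros\<close>)
  have eq: "w k x = integral {a..x} (slope k (\<lambda>t. w k (max a (t - \<delta>))))" if "x \<in> {a..b}" for k x
    using delayed_stationary[of \<delta> x N k] that N assms(1) by (simp add: w_def)
  have wb: "continuous_on {- R..R} (\<lambda>k. w k b)"
  proof -
    have "continuous_on {- R..R} (\<lambda>k. (k, b))" by (intro continuous_intros)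
    moreover have "(\<lambda>k. (k, b)) ` {- R..R} \<subseteq> UNIV \<times> {a..b}" using ab by auto
    ultimately show ?thesis using continuous_on_compose2[OF jc] by fastforce
  qed
  have i: "slope k (\<lambda>t. w k (max a (t - \<delta>))) integrable_on {a..b}" for k
    by (intro integrable_continuous_interval slope_continuous uc)
  have "w R b \<ge> 0"
    unfolding eq[of b R, OF atLeastAtMost_iff[THEN iffD2, OF conjI[OF less_imp_le[OF ab] order_refl]]]
    by (intro integral_nonneg i R uc)
  moreover have "w (- R) b \<le> 0"
    unfolding eq[of b "- R", OF atLeastAtMost_iff[THEN iffD2, OF conjI[OF less_imp_le[OF ab] order_refl]]]
    using integral_le[OF i integrable_0, of "- R"] R(2)[OF uc, of _ "- R"] by simp
  ultimately obtain k where "- R \<le> k" "k \<le> R" "w k b = 0"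
    using IVT'[of "\<lambda>k. w k b" "- R" 0 R] wb assms(2) by auto
  then show thesis using that[of k "w k"] wc eq by auto
qed

theorem solution_exists:
  obtains k w where "continuous_on {a..b} w" "w b = 0"
    "\<And>x. x \<in> {a..b} \<Longrightarrow> w x = integral {a..x} (slope k w)"
proof -
  obtain R M where R: "R > 0"
    "\<And>u s. continuous_on {a..b} u \<Longrightarrow> s \<in> {a..b} \<Longrightarrow> slope R u s \<ge> 0"
    "\<And>u s. continuous_on {a..b} u \<Longrightarrow> s \<in> {a..b} \<Longrightarrow> slope (- R) u s \<le> 0"
    and M: "\<And>k u s. \<bar>k\<bar> \<le> R \<Longrightarrow> continuous_on {a..b} u \<Longrightarrow> s \<in> {a..b} \<Longrightarrow> \<bar>slope k u s\<bar> \<le> M"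
    using slope_bounds by metis
  define \<delta> where "\<delta> n = inverse (real (Suc n))" for n
  have \<delta>0: "\<delta> n > 0" for n by (simp add: \<delta>_def)
  have "\<exists>k w. \<bar>k\<bar> \<le> R \<and> continuous_on {a..b} w \<and> w b = 0 \<and>
    (\<forall>x\<in>{a..b}. w x = integral {a..x} (slope k (\<lambda>t. w (max a (t - \<delta> n)))))" for n
    using delay_solution[OF \<delta>0 R] by metis
  then obtain k0 w0 where k0: "\<And>n. \<bar>k0 n\<bar> \<le> R" and w0: "\<And>n. continuous_on {a..b} (w0 n)" "\<And>n. w0 n b = 0"
    "\<And>n x. x \<in> {a..b} \<Longrightarrow> w0 n x = integral {a..x} (slope (k0 n) (\<lambda>t. w0 n (max a (t - \<delta> n))))"
    by metis
  have "M \<ge> 0" using M[of 0 "\<lambda>x. 0" a] R(1) ab by force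
  have uc: "continuous_on {a..b} (\<lambda>t. w0 n (max a (t - \<delta> n)))" for n
    by (rule continuous_on_compose2[OF w0(1)]) (use \<delta>0[of n] ab in \<open>auto intro!: continuous_intros\<close>)
  have lip': "\<bar>w0 n x - w0 n y\<bar> \<le> M * (x - y)" if "a \<le> y" "y \<le> x" "x \<le> b" for n x y
  proof -
    let ?f = "slope (k0 n) (\<lambda>t. w0 n (max a (t - \<delta> n)))"
    have c: "continuous_on {a..b} ?f" by (intro slope_continuous uc)
    have "?f integrable_on {a..x}"
      by (intro integrable_continuous_interval continuous_on_subset[OF c]) (use that in auto)
    then have "integral {a..y} ?f + integral {y..x} ?f = integral {a..x} ?f"
      using that by (intro Henstock_Kurzweil_Integration.integral_combine) auto
    then have "w0 n x - w0 n y = integral {y..x} ?f"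
      using w0(3)[of x n] w0(3)[of y n] that by auto
    moreover have "norm (integral {y..x} ?f) \<le> M * (x - y)"
      using that by (intro integral_bound continuous_on_subset[OF c] ) (auto intro!: M k0 uc)
    ultimately show ?thesis by simp
  qed
  have lip: "\<bar>w0 n x - w0 n y\<bar> \<le> M * \<bar>x - y\<bar>" if "x \<in> {a..b}" "y \<in> {a..b}" for n x y
    using lip'[of y x n] lip'[of x y n] that by (cases "x \<le> y") (auto simp: abs_minus_commute)
  have "bounded (range k0)" using k0 by (auto simp: bounded_iff)
  \<comment> \<open>Two extractions: Bolzano-Weierstrass for the parameters, then Arzela-Ascoli for
    the functions along that subsequence; \<open>\<sigma>\<close> composes them.\<close>
  then obtain k r where r: "strict_mono r" "(\<lambda>n. k0 (r n)) \<longlonglongrightarrow> k"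
    using bounded_imp_convergent_subsequence[of k0] by (auto simp: o_def)
  have bnd: "norm (w0 (r n) x) \<le> M * (b - a)" if "x \<in> {a..b}" for n x
  proof -
    have "\<bar>w0 (r n) x - w0 (r n) b\<bar> \<le> M * \<bar>x - b\<bar>" using that ab by (intro lip) auto
    also have "\<dots> \<le> M * (b - a)" using that \<open>M \<ge> 0\<close> by (intro mult_left_mono) auto
    finally show ?thesis using w0(2) by simp
  qed
  have eqc: "\<exists>d. 0 < d \<and> (\<forall>n y. y \<in> {a..b} \<and> norm (x - y) < d \<longrightarrow> norm (w0 (r n) x - w0 (r n) y) < e)"
    if "x \<in> {a..b}" "0 < e" for x e
  \<comment> \<open>The common Lipschitz constant \<open>M\<close> may be 0, hence
    \<open>M + 1\<close>.\<close>
  proof (intro exI[of _ "e / (M + 1)"] conjI allI impI)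
    show "0 < e / (M + 1)" using that \<open>M \<ge> 0\<close> by simp
    fix n y assume y: "y \<in> {a..b} \<and> norm (x - y) < e / (M + 1)"
    have "norm (w0 (r n) x - w0 (r n) y) \<le> M * \<bar>x - y\<bar>" using lip that y by simp
    also have "\<dots> \<le> (M + 1) * \<bar>x - y\<bar>" by (simp add: mult_right_mono)
    also have "\<dots> < e" using y \<open>M \<ge> 0\<close> by (simp add: pos_less_divide_eq mult.commute)
    finally show "norm (w0 (r n) x - w0 (r n) y) < e" .
  qed
  obtain w q where w: "continuous_on {a..b} w" and q: "strict_mono (q :: nat \<Rightarrow> nat)"
    and lim: "\<And>e. 0 < e \<Longrightarrow> \<exists>N. \<forall>n x. n \<ge> N \<and> x \<in> {a..b} \<longrightarrow> norm (w0 (r (q n)) x - w x) < e"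
    using Arzela_Ascoli[of "{a..b}" "\<lambda>n. w0 (r n)", OF compact_Icc bnd eqc] by metis
  define \<sigma> where "\<sigma> n = r (q n)" for n
  have \<sigma>: "strict_mono \<sigma>" using r(1) q by (auto simp: strict_mono_def \<sigma>_def)
  have wl: "(\<lambda>n. w0 (\<sigma> n) x) \<longlonglongrightarrow> w x" if "x \<in> {a..b}" for x
    using lim that unfolding \<sigma>_def by (intro LIMSEQ_I) blast
  have kl: "(\<lambda>n. k0 (\<sigma> n)) \<longlonglongrightarrow> k"
    using LIMSEQ_subseq_LIMSEQ[OF r(2) q] by (simp add: o_def \<sigma>_def)
  have \<delta>l: "(\<lambda>n. \<delta> (\<sigma> n)) \<longlonglongrightarrow> 0"
    using LIMSEQ_subseq_LIMSEQ[OF LIMSEQ_inverse_real_of_nat \<sigma>] by (simp add: o_def \<delta>_def)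
  define u where "u n t = w0 (\<sigma> n) (max a (t - \<delta> (\<sigma> n)))" for n t
  have uc': "continuous_on {a..b} (u n)" for n unfolding u_def by (rule uc)
  have ul: "(\<lambda>n. u n t) \<longlonglongrightarrow> w t" if "t \<in> {a..b}" for t
  proof -
    \<comment> \<open>The Lipschitz bound, uniform in \<open>n\<close>, makes the effect of the
      delay proportional to its length.\<close>
    have "\<bar>u n t - w0 (\<sigma> n) t\<bar> \<le> M * \<delta> (\<sigma> n)" for n
    proof -
      have "\<bar>u n t - w0 (\<sigma> n) t\<bar> \<le> M * \<bar>max a (t - \<delta> (\<sigma> n)) - t\<bar>"
        unfolding u_def using that \<delta>0[of "\<sigma> n"] by (intro lip) auto
      also have "\<dots> \<le> M * \<delta> (\<sigma> n)"
        using that \<delta>0[of "\<sigma> n"] \<open>M \<ge> 0\<close> by (intro mult_left_mono) auto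
      finally show ?thesis .
    qed
    moreover have "(\<lambda>n. M * \<delta> (\<sigma> n)) \<longlonglongrightarrow> 0" using tendsto_mult[OF tendsto_const \<delta>l, of M] by simp
    ultimately have "(\<lambda>n. u n t - w0 (\<sigma> n) t) \<longlonglongrightarrow> 0"
      by (intro Lim_null_comparison[of "\<lambda>n. u n t - w0 (\<sigma> n) t" "\<lambda>n. M * \<delta> (\<sigma> n)"]) auto
    from tendsto_add[OF this wl[OF that]] show ?thesis by simp
  qed
  have Gc: "continuous_on {a..b} (\<lambda>t. G (v t))" if "continuous_on {a..b} v" for v
    using continuous_on_compose2[OF G(1) that] by auto
  have sub: "f \<in> borel_measurable (lebesgue_on {a..s})" if "continuous_on {a..b} f" "s \<in> {a..b}" for f :: "real \<Rightarrow> real" and s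
    using that by (intro borel_measurable_continuous_lebesgue_on_Icc continuous_on_subset[OF that(1)]) auto
  have Il: "(\<lambda>n. integral {a..s} (\<lambda>t. G (u n t))) \<longlonglongrightarrow> integral {a..s} (\<lambda>t. G (w t))" if s: "s \<in> {a..b}" for s
  proof (rule bounded_convergence_integral[where M=J])
    show "\<bar>G (u n x)\<bar> \<le> J" for n x using G_pos[of "u n x"] G(3) by simp
    show "AE x in lebesgue_on {a..s}. (\<lambda>n. G (u n x)) \<longlonglongrightarrow> G (w x)"
    proof (rule AE_I2)
      fix x assume "x \<in> space (lebesgue_on {a..s})"
      then have "x \<in> {a..b}" using s by auto
      then show "(\<lambda>n. G (u n x)) \<longlonglongrightarrow> G (w x)"
        using continuous_on_tendsto_compose[OF G(1) ul] by auto
    qed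
  qed (intro sub[OF Gc s] uc' w)+
  have sl: "(\<lambda>n. slope (k0 (\<sigma> n)) (u n) s) \<longlonglongrightarrow> slope k w s" if s: "s \<in> {a..b}" for s
    unfolding slope_def
  proof (intro tendsto_intros kl Il s)
    show "(\<lambda>n. G (u n s)) \<longlonglongrightarrow> G (w s)"
      using continuous_on_tendsto_compose[OF G(1) ul[OF s]] by auto
  qed (use p(2)[OF s] G_pos[of "w s"] in auto)
  have "w x = integral {a..x} (slope k w)" if x: "x \<in> {a..b}" for x
  proof -
    have "(\<lambda>n. integral {a..x} (slope (k0 (\<sigma> n)) (u n))) \<longlonglongrightarrow> integral {a..x} (slope k w)"
    proof (rule bounded_convergence_integral[where M=M])
      show "\<bar>slope (k0 (\<sigma> n)) (u n) s\<bar> \<le> M" if "s \<in> {a..x}" for n s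
        using that x by (intro M k0 uc') auto
      show "AE s in lebesgue_on {a..x}. (\<lambda>n. slope (k0 (\<sigma> n)) (u n) s) \<longlonglongrightarrow> slope k w s"
        using x by (intro AE_I2 sl) auto
    qed (intro sub[OF slope_continuous x] uc' w)+
    moreover have "integral {a..x} (slope (k0 (\<sigma> n)) (u n)) = w0 (\<sigma> n) x" for n
      using w0(3)[OF x, of "\<sigma> n"] by (simp add: u_def[abs_def])
    ultimately show ?thesis using LIMSEQ_unique[OF wl[OF x]] by simp
  qed
  moreover have "w b = 0" using LIMSEQ_unique[OF wl[of b]] w0(2) ab by simp
  ultimately show thesis using that w by blast
qed

end

subsection \<open>The supersonic profile\<close>

text \<open>A primitive of \<open>1/m - J^2/m^3\<close>, the coefficient of the derivative of
  \<open>m\<close> in the equation, so that the degenerate diffusion term becomes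
  \<open>p w'\<close>.\<close>

definition enthalpy :: "real \<Rightarrow> real \<Rightarrow> real" where
  "enthalpy J m = ln (m / J) + J\<^sup>2 / (2 * m\<^sup>2) - 1 / 2"

lemma enthalpy_J: "J > 0 \<Longrightarrow> enthalpy J J = 0"
  by (simp add: enthalpy_def)

lemma enthalpy_deriv:
  assumes "0 < m" "0 < J"
  shows "(enthalpy J has_real_derivative (m\<^sup>2 - J\<^sup>2) / m ^ 3) (at m)"
proof -
  have "((\<lambda>m. ln (m / J) + J\<^sup>2 / (2 * m\<^sup>2) - 1 / 2) has_real_derivative (m\<^sup>2 - J\<^sup>2) / m ^ 3) (at m)"
    using assms by (auto intro!: derivative_eq_intros simp: field_simps power2_eq_square power3_eq_cube)
  then show ?thesis by (simp add: enthalpy_def[abs_def])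
qed

lemma enthalpy_continuous: "0 < x \<Longrightarrow> 0 < J \<Longrightarrow> continuous_on {x..y} (enthalpy J)"
  by (intro continuous_at_imp_continuous_on ballI DERIV_isCont[OF enthalpy_deriv]) auto

lemma enthalpy_strict_antimono:
  assumes "0 < x" "x < y" "y \<le> J"
  shows "enthalpy J y < enthalpy J x"
proof (rule DERIV_neg_imp_decreasing_open[OF assms(2)])
  fix m assume m: "x < m" "m < y"
  have "m\<^sup>2 < J\<^sup>2" using m assms by (intro power_strict_mono) auto
  then have "(m\<^sup>2 - J\<^sup>2) / m ^ 3 < 0" using m assms by (intro divide_neg_pos) auto
  then show "\<exists>D. (enthalpy J has_real_derivative D) (at m) \<and> D < 0"
    using enthalpy_deriv[of m J] m assms by auto
next
  show "continuous_on {x..y} (enthalpy J)"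
    using assms by (intro enthalpy_continuous) auto
qed

lemma enthalpy_unbounded:
  assumes "J > 0"
  obtains l where "0 < l" "l < J" "W < enthalpy J l"
proof -
  \<comment> \<open>With \<open>x = J / l\<close> the enthalpy is \<open>x^2/2 - 1/2 - ln x\<close>,
    which \<open>ln x \<le> x - 1\<close> bounds below by \<open>(x - 1)^2 / 2\<close>. The choice
    of \<open>x\<close> makes this equal to \<open>|W| + 1\<close>.\<close>
  define x where "x = 1 + sqrt (2 * (\<bar>W\<bar> + 1))"
  have x: "x > 1" "(x - 1)\<^sup>2 = 2 * (\<bar>W\<bar> + 1)" by (simp_all add: x_def)
  have "enthalpy J (J / x) = x\<^sup>2 / 2 - 1 / 2 - ln x"
    using assms x(1) by (simp add: enthalpy_def ln_div power_divide)
  also have "\<dots> \<ge> x\<^sup>2 / 2 - 1 / 2 - (x - 1)" using ln_le_minus_one[of x] x(1) by simp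
  also have "x\<^sup>2 / 2 - 1 / 2 - (x - 1) = (x - 1)\<^sup>2 / 2" by (simp add: power2_eq_square field_simps)
  finally have "enthalpy J (J / x) > W" using x(2) by simp
  then show thesis using that[of "J / x"] assms x(1) by (simp add: divide_less_eq)
qed

text \<open>Invert the enthalpy on the compact interval \<open>{l..J}\<close>, where the inverse is
  continuous, and clamp the argument to its range. Clamping from below produces the value
  \<open>J\<close> for all \<open>w \<le> 0\<close>, on which the positivity argument rests.\<close>

lemma enthalpy_truncated_inverse:
  assumes "0 < l" "l < J"
  obtains G where "continuous_on UNIV G" "\<And>w. l \<le> G w" "\<And>w. G w \<le> J" "\<And>w. w \<le> 0 \<Longrightarrow> G w = J"
    "\<And>w. 0 \<le> w \<Longrightarrow> w \<le> enthalpy J l \<Longrightarrow> enthalpy J (G w) = w"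
proof -
  define F where "F = enthalpy J"
  have Fc: "continuous_on {l..J} F"
    unfolding F_def using assms by (intro enthalpy_continuous) auto
  have anti: "F y < F x" if "l \<le> x" "x < y" "y \<le> J" for x y
    unfolding F_def using that assms by (intro enthalpy_strict_antimono) auto
  have inj: "inj_on F {l..J}"
    by (rule inj_onI) (metis anti atLeastAtMost_iff less_irrefl linorder_neqE_linordered_idom)
  have FJ: "F J = 0" using assms by (simp add: F_def enthalpy_J)
  have Fl: "F l > 0" using anti[of l J] assms FJ by simp
  define g where "g = inv_into {l..J} F"
  have im: "F ` {l..J} = {0..F l}"
  proof
    show "F ` {l..J} \<subseteq> {0..F l}"
      using anti FJ by (force simp: le_less)
    show "{0..F l} \<subseteq> F ` {l..J}"
      using IVT2'[of F J _ l] FJ Fc assms by force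
  qed
  have gc: "continuous_on {0..F l} g"
    unfolding im[symmetric] g_def by (rule continuous_on_inv[OF Fc compact_Icc]) (simp add: inj)
  have gm: "g w \<in> {l..J}" "F (g w) = w" if "w \<in> {0..F l}" for w
    using that im unfolding g_def by (metis inv_into_into, metis f_inv_into_f)
  define G where "G w = g (max 0 (min (F l) w))" for w
  have cl: "max 0 (min (F l) w) \<in> {0..F l}" for w using Fl by auto
  show thesis
  proof
    show "continuous_on UNIV G" unfolding G_def
      by (rule continuous_on_compose2[OF gc]) (use cl in \<open>auto intro!: continuous_intros\<close>)
    show "l \<le> G w" "G w \<le> J" for w using gm(1)[OF cl] by (auto simp: G_def)
    show "enthalpy J (G w) = w" if "0 \<le> w" "w \<le> enthalpy J l" for w
      using gm(2)[of w] that by (simp add: G_def F_def)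
    show "G w = J" if "w \<le> 0" for w
    proof -
      have "G w = g (F J)" using that Fl FJ by (simp add: G_def)
      also have "\<dots> = J" unfolding g_def using assms by (intro inv_into_f_f inj) auto
      finally show ?thesis .
    qed
  qed
qed

section \<open>Sign information and the a priori bound\<close>

lemma (in flux_problem) slope_solution_deriv:
  assumes "continuous_on {a..b} w" "\<And>x. x \<in> {a..b} \<Longrightarrow> w x = integral {a..x} (slope k w)" "x \<in> {a<..<b}"
  shows "(w has_real_derivative slope k w x) (at x)"
proof -
  have "((\<lambda>x. integral {a..x} (slope k w)) has_vector_derivative slope k w x) (at x within {a..b})"
    using assms by (intro integral_has_vector_derivative slope_continuous) auto
  then have "((\<lambda>x. integral {a..x} (slope k w)) has_real_derivative slope k w x) (at x)"
    using assms(3) by (simp add: has_real_derivative_iff_has_vector_derivative at_within_Icc_at)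
  then show ?thesis
    by (rule has_field_derivative_transform_within_open[where S="{a<..<b}"]) (use assms in auto)
qed

text \<open>At an interior minimum \<open>z\<close> with \<open>w z \<le> 0\<close> the flux \<open>p w'\<close> vanishes, and since \<open>G \<le> J = G (w z)\<close> the
  hypothesis makes it negative to the right of \<open>z\<close>; then \<open>w b < 0\<close>.\<close>

lemma (in flux_problem) solution_pos:
  assumes wc: "continuous_on {a..b} w" and w: "\<And>x. x \<in> {a..b} \<Longrightarrow> w x = integral {a..x} (slope k w)"
    and wb: "w b = 0" and GJ: "\<And>w. w \<le> 0 \<Longrightarrow> G w = J"
    and strict: "\<And>x y. a \<le> x \<Longrightarrow> x < y \<Longrightarrow> y \<le> b \<Longrightarrow> J * (y - x) < D y - D x + lam / J * (p y - p x)"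
    and x: "x \<in> {a<..<b}"
  shows "w x > 0"
proof (rule ccontr)
  assume neg: "\<not> w x > 0"
  have wa: "w a = 0" using w[of a] ab by simp
  have J: "J > 0" using G_pos[of 0] GJ[of 0] by simp
  obtain z0 where z0: "z0 \<in> {a..b}" "\<And>y. y \<in> {a..b} \<Longrightarrow> w z0 \<le> w y"
    using continuous_attains_inf[OF compact_Icc _ wc] ab by auto
  \<comment> \<open>Either the global minimum is negative and so not attained at an endpoint, or it
    is nonnegative and the point \<open>x\<close>, where \<open>w x \<le> 0\<close>, is itself a
    minimizer.\<close>
  obtain z where z: "z \<in> {a<..<b}" "w z \<le> 0" "\<And>y. y \<in> {a..b} \<Longrightarrow> w z \<le> w y"
  proof (cases "w z0 < 0")
    case True
    then have "z0 \<noteq> a" "z0 \<noteq> b" using wa wb by auto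
    then show thesis using that[of z0] z0 True by auto
  next
    case False
    then show thesis using that[of x] x neg z0(2) by force
  qed
  have "slope k w z = 0"
  proof (rule DERIV_local_min[OF slope_solution_deriv[OF wc w z(1)]])
    show "0 < min (z - a) (b - z)" using z by auto
    show "\<forall>y. \<bar>z - y\<bar> < min (z - a) (b - z) \<longrightarrow> w z \<le> w y"
      by (intro allI impI z(3)) (auto simp: abs_less_iff)
  qed
  then have sz: "k + integral {a..z} (\<lambda>t. G (w t)) - D z - lam * p z / J = 0"
    using p(2)[of z] z GJ[OF z(2)] by (simp add: slope_def field_simps)
  have neg_slope: "slope k w y < 0" if y: "z < y" "y < b" for y
  proof -
    have "continuous_on {a..y} (\<lambda>t. G (w t))"
      using y z by (intro continuous_on_compose2[OF G(1) continuous_on_subset[OF wc]]) auto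
    then have i: "(\<lambda>t. G (w t)) integrable_on {a..y}" by (rule integrable_continuous_interval)
    have "integral {a..y} (\<lambda>t. G (w t)) = integral {a..z} (\<lambda>t. G (w t)) + integral {z..y} (\<lambda>t. G (w t))"
      using i y z by (intro Henstock_Kurzweil_Integration.integral_combine[symmetric]) auto
    moreover have "integral {z..y} (\<lambda>t. G (w t)) \<le> integral {z..y} (\<lambda>t. J)"
      using z by (intro integral_le integrable_on_subinterval[OF i]) (auto simp: G)
    moreover have "integral {z..y} (\<lambda>t. J) = J * (y - z)" using y by (simp add: mult.commute)
    moreover have "J * (y - z) < D y - D z + lam / J * (p y - p z)" using y z by (intro strict) auto
    moreover have py: "p y > 0" using p(2)[of y] y z by auto
    moreover have "lam * p y / J \<le> lam * p y / G (w y)"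
      using lam py G(3)[of "w y"] G_pos[of "w y"] by (intro divide_left_mono) auto
    moreover have "lam / J * (p y - p z) = lam * p y / J - lam * p z / J"
      by (simp add: right_diff_distrib diff_divide_distrib)
    ultimately have "k + integral {a..y} (\<lambda>t. G (w t)) - D y - lam * p y / G (w y) < 0"
      using sz by linarith
    moreover have "slope k w y = (k + integral {a..y} (\<lambda>t. G (w t)) - D y - lam * p y / G (w y)) / p y"
      using py by (simp add: slope_def field_simps)
    ultimately show ?thesis using py by (simp add: divide_neg_pos)
  qed
  have "w b < w z"
  proof (rule DERIV_neg_imp_decreasing_open[of z b w])
    show "\<exists>e. (w has_real_derivative e) (at y) \<and> e < 0" if "z < y" "y < b" for y
      using slope_solution_deriv[OF wc w, of y] neg_slope[OF that] that z by auto
    show "continuous_on {z..b} w" by (rule continuous_on_subset[OF wc]) (use z in auto)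
  qed (use z in auto)
  then show False using wb z by simp
qed

text \<open>If the slope were positive at \<open>b\<close>, it would be so nearby by continuity, and
  \<open>w\<close> would increase to its value 0 at \<open>b\<close>, contradicting positivity in
  the interior.\<close>

lemma (in flux_problem) slope_b_nonpos:
  assumes wc: "continuous_on {a..b} w" and w: "\<And>x. x \<in> {a..b} \<Longrightarrow> w x = integral {a..x} (slope k w)"
    and wb: "w b = 0" and pos: "\<And>x. x \<in> {a<..<b} \<Longrightarrow> w x > 0"
  shows "slope k w b \<le> 0"
proof (rule ccontr)
  assume "\<not> slope k w b \<le> 0"
  moreover have "continuous_on {a..b} (slope k w)" by (rule slope_continuous[OF wc])
  ultimately have "\<forall>\<^sub>F x in at b within {a..b}. slope k w x > 0"
    using ab by (intro order_tendstoD(1)[of _ "slope k w b"]) (auto simp: continuous_on)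
  then obtain e where e: "e > 0" "\<And>x. x \<in> {a..b} \<Longrightarrow> x \<noteq> b \<Longrightarrow> dist x b < e \<Longrightarrow> slope k w x > 0"
    by (auto simp: eventually_at)
  define c where "c = max ((a + b) / 2) (b - e / 2)"
  have c: "c \<in> {a<..<b}" "b - e < c" using ab e(1) by (auto simp: c_def max_def)
  have "w c < w b"
  proof (rule DERIV_pos_imp_increasing_open[of c b w])
    show "\<exists>e. (w has_real_derivative e) (at y) \<and> e > 0" if "c < y" "y < b" for y
    proof -
      have "slope k w y > 0" using that c by (intro e) (auto simp: dist_real_def)
      then show ?thesis using slope_solution_deriv[OF wc w, of y] that c by auto
    qed
    show "continuous_on {c..b} w" by (rule continuous_on_subset[OF wc]) (use c in auto)
  qed (use c in auto)
  then show False using pos[OF c(1)] wb by simp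
qed

text \<open>Because \<open>d\<close> is only integrable, the subsolution property of the constant
  \<open>m = J\<close> is expressed by increments over subintervals instead of pointwise.\<close>

theorem supersonic_profile_exists:
  fixes a b lam J M :: real and p d :: "real \<Rightarrow> real"
  assumes ab: "a < b" and lam: "lam \<ge> 0" and J: "J > 0"
    and p: "continuous_on {a..b} p" "\<And>x. x \<in> {a..b} \<Longrightarrow> 0 < p x"
    and d: "d integrable_on {a..b}"
    and strict: "\<And>x y. a \<le> x \<Longrightarrow> x < y \<Longrightarrow> y \<le> b \<Longrightarrow> J * (y - x) < integral {x..y} d + lam / J * (p y - p x)"
  obtains m v' k l where "continuous_on {a..b} m" "m a = J" "m b = J" "l > 0"
    "\<And>x. x \<in> {a..b} \<Longrightarrow> l \<le> m x" "\<And>x. x \<in> {a..b} \<Longrightarrow> m x \<le> J" "\<And>x. x \<in> {a<..<b} \<Longrightarrow> m x < J"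
    "continuous_on {a..b} v'" "\<And>x. x \<in> {a<..<b} \<Longrightarrow> ((\<lambda>r. (m r - J)\<^sup>2) has_real_derivative v' x) (at x)"
    "\<And>x. x \<in> {a..b} \<Longrightarrow> p x * ((m x + J) / (2 * m x ^ 3)) * v' x + p x * lam / m x = k + integral {a..x} (\<lambda>t. m t - d t)"
proof -
  define D where "D x = integral {a..x} d" for x
  have Dc: "continuous_on {a..b} D" unfolding D_def by (rule indefinite_integral_continuous_1[OF d])
  have Ddiff: "D y - D x = integral {x..y} d" if "a \<le> x" "x \<le> y" "y \<le> b" for x y
    using Henstock_Kurzweil_Integration.integral_combine[of a x y d] integrable_on_subinterval[OF d, of a y] that by (simp add: D_def)
  obtain x0 where x0: "x0 \<in> {a..b}" "\<And>x. x \<in> {a..b} \<Longrightarrow> p x0 \<le> p x"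
    using continuous_attains_inf[OF compact_Icc _ p(1)] ab by auto
  obtain Dm where Dm: "\<And>x. x \<in> {a..b} \<Longrightarrow> \<bar>D x\<bar> \<le> Dm"
    using compact_imp_bounded[OF compact_continuous_image[OF Dc compact_Icc]]
    by (force simp: bounded_iff)
  have Dm0: "Dm \<ge> 0" using Dm[of a] ab by force
  \<comment> \<open>Upper bound for \<open>k\<close>: at \<open>b\<close> the slope is nonpositive
    and \<open>G\<close> has the value \<open>J\<close>, so \<open>k\<close> plus a nonnegative
    integral is at most \<open>D b + lam * p b / J\<close>.\<close>
  define K where "K = lam * p b / J + Dm"
  \<comment> \<open>Upper bound for the slope, obtained by discarding the term
    \<open>- lam / G\<close> and estimating the integral of \<open>G\<close> by
    \<open>J * (b - a)\<close>.\<close>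
  define A where "A = (K + J * (b - a) + Dm) / p x0"
  have K0: "K \<ge> 0" unfolding K_def using lam J p(2)[of b] ab Dm0 by auto
  have A0: "A \<ge> 0" unfolding A_def using K0 J ab Dm0 p(2)[OF x0(1)] by (intro divide_nonneg_pos) auto
  \<comment> \<open>\<open>K\<close> and \<open>A\<close> come from the data alone, so
    \<open>l\<close> can be chosen here such that \<open>w\<close> will stay in the range on which
    \<open>G\<close> inverts the enthalpy.\<close>
  obtain l where l0: "0 < l" "l < J" "A * (b - a) < enthalpy J l"
    using enthalpy_unbounded[OF J] by metis
  obtain G where G0: "continuous_on UNIV G" "\<And>w. l \<le> G w" "\<And>w. G w \<le> J" and GJ: "\<And>w. w \<le> 0 \<Longrightarrow> G w = J"
    and Ge: "\<And>w. 0 \<le> w \<Longrightarrow> w \<le> enthalpy J l \<Longrightarrow> enthalpy J (G w) = w"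
    using enthalpy_truncated_inverse[OF l0(1,2)] by metis
  interpret flux_problem a b lam l J p D G
    by unfold_locales (use ab lam l0 p Dc G0 in auto)
  obtain k w where wc: "continuous_on {a..b} w" and wb: "w b = 0"
    and w: "\<And>x. x \<in> {a..b} \<Longrightarrow> w x = integral {a..x} (slope k w)"
    using solution_exists by metis
  have wa: "w a = 0" using w[of a] ab by simp
  have pos: "w x > 0" if "x \<in> {a<..<b}" for x
    by (rule solution_pos[OF wc w wb GJ _ that]) (use strict Ddiff in auto)
  have "slope k w b \<le> 0" by (rule slope_b_nonpos[OF wc w wb pos])
  then have "k + integral {a..b} (\<lambda>t. G (w t)) - D b \<le> lam * p b / J"
    using p(2)[of b] ab GJ[of "w b"] wb by (simp add: slope_def field_simps)
  then have kK: "k \<le> K"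
    using integral_G_bounds(1)[OF wc, of b] Dm[of b] ab unfolding K_def by auto
  have sA: "slope k w s \<le> A" if s: "s \<in> {a..b}" for s
  proof -
    have "(k + integral {a..s} (\<lambda>t. G (w t)) - D s) / p s \<le> (K + J * (b - a) + Dm) / p x0"
      using integral_G_bounds(2)[OF wc s] kK Dm[OF s] x0(2)[OF s] p(2)[OF x0(1)] K0 J ab Dm0
      by (intro frac_le) auto
    moreover have "lam / G (w s) \<ge> 0" using lam G_pos[of "w s"] by simp
    ultimately show ?thesis unfolding slope_def A_def by linarith
  qed
  have wA: "w x \<le> A * (b - a)" if x: "x \<in> {a..b}" for x
  proof -
    have "slope k w integrable_on {a..x}"
      using x by (intro integrable_continuous_interval continuous_on_subset[OF slope_continuous[OF wc]]) auto
    then have "integral {a..x} (slope k w) \<le> integral {a..x} (\<lambda>s. A)"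
      using sA x by (intro integral_le) auto
    also have "\<dots> \<le> A * (b - a)" using x A0 by (auto simp: mult.commute intro!: mult_left_mono)
    finally show ?thesis using w[OF x] by simp
  qed
  have w0: "0 \<le> w x" if "x \<in> {a..b}" for x
    using pos[of x] wa wb that by (cases "x = a \<or> x = b") (auto intro: less_imp_le)
  define m where "m x = G (w x)" for x
  have em: "enthalpy J (m x) = w x" if "x \<in> {a..b}" for x
    unfolding m_def using w0[OF that] wA[OF that] l0(3) by (intro Ge) auto
  have m0: "m x > 0" for x using G_pos by (simp add: m_def)
  have mJ: "m x < J" if "x \<in> {a<..<b}" for x
  proof -
    have "m x \<noteq> J" using em[of x] enthalpy_J[OF J] pos[OF that] that by auto
    then show ?thesis using G(3)[of "w x"] by (simp add: m_def)
  qed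
  have mc: "continuous_on {a..b} m" unfolding m_def by (rule continuous_on_compose2[OF G(1) wc]) auto
  \<comment> \<open>The derivative \<open>2 * (m - J) * m'\<close> with
    \<open>m' = w' * m^3 / ((m - J) * (m + J))\<close>: after cancelling \<open>m - J\<close> the
    expression is continuous up to the endpoints.\<close>
  define v' where "v' x = 2 * m x ^ 3 / (m x + J) * slope k w x" for x
  have mpJ: "m x + J \<noteq> 0" for x using m0[of x] J by simp
  show thesis
  proof
    show "continuous_on {a..b} m" by (rule mc)
    show "m a = J" "m b = J" using wa wb GJ by (simp_all add: m_def)
    show "l > 0" by (rule l0(1))
    show "l \<le> m x" "m x \<le> J" for x using G by (simp_all add: m_def)
    show "m x < J" if "x \<in> {a<..<b}" for x by (rule mJ[OF that])
    show "continuous_on {a..b} v'"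
      unfolding v'_def by (intro continuous_intros mc slope_continuous[OF wc]) (use mpJ in auto)
    show "((\<lambda>r. (m r - J)\<^sup>2) has_real_derivative v' x) (at x)" if x: "x \<in> {a<..<b}" for x
    proof -
      let ?E = "((m x)\<^sup>2 - J\<^sup>2) / m x ^ 3"
      have sq: "(m x)\<^sup>2 - J\<^sup>2 = (m x - J) * (m x + J)" by (simp add: power2_eq_square algebra_simps)
      have nz: "?E \<noteq> 0" using mJ[OF x] m0[of x] J by (simp add: sq)
      \<comment> \<open>The inverse function rule applies only at interior points: there
        \<open>m x < J\<close>, so the derivative of the enthalpy is nonzero.\<close>
      have "(G has_real_derivative inverse ?E) (at (w x))"
      proof (rule DERIV_inverse_function[where f="enthalpy J" and a=0 and b="enthalpy J l"])
        show "(enthalpy J has_real_derivative ?E) (at (G (w x)))"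
          using enthalpy_deriv[OF m0[of x] J] by (simp add: m_def)
        show "isCont G (w x)" using G(1) by (simp add: continuous_on_eq_continuous_at)
        show "w x < enthalpy J l" using wA[of x] l0(3) x by auto
      qed (use nz pos[OF x] Ge in auto)
      from DERIV_chain2[OF this slope_solution_deriv[OF wc w x]]
      have "(m has_real_derivative inverse ?E * slope k w x) (at x)" by (simp add: m_def[abs_def])
      then have "((\<lambda>r. (m r - J)\<^sup>2) has_real_derivative 2 * (m x - J) * (inverse ?E * slope k w x)) (at x)"
        by (auto intro!: derivative_eq_intros)
      moreover have "2 * (m x - J) * (inverse ?E * slope k w x) = v' x"
      proof -
        have "2 * q * (inverse (q * r / c) * s) = 2 * c / r * s" if "q \<noteq> 0" "r \<noteq> 0" "c \<noteq> 0" for q r c s :: real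
          using that by (simp add: field_simps)
        then show ?thesis
          unfolding sq v'_def by this (use mJ[OF x] mpJ[of x] m0[of x] in auto)
      qed
      ultimately show ?thesis by simp
    qed
    show "p x * ((m x + J) / (2 * m x ^ 3)) * v' x + p x * lam / m x = k + integral {a..x} (\<lambda>t. m t - d t)"
      if x: "x \<in> {a..b}" for x
    proof -
      have "integral {a..x} (\<lambda>t. m t - d t) = integral {a..x} m - integral {a..x} d"
        using x by (intro Henstock_Kurzweil_Integration.integral_diff integrable_continuous_interval
            continuous_on_subset[OF mc] integrable_on_subinterval[OF d]) auto
      moreover have "p x * ((m x + J) / (2 * m x ^ 3)) * v' x = p x * slope k w x"
        using mpJ[of x] m0[of x] by (simp add: v'_def)
      moreover have "p x * slope k w x = k + integral {a..x} m - D x - p x * lam / m x"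
        using p(2)[OF x] m0[of x] by (simp add: slope_def m_def[symmetric] m_def[abs_def, symmetric] field_simps)
      ultimately show ?thesis by (simp add: D_def)
    qed
  qed
qed

section \<open>Essential bounds, Hoelder continuity and the weak solution\<close>

lemma AE_lebesgue_on_iff:
  "S \<in> sets lebesgue \<Longrightarrow> (AE x in lebesgue_on S. P x) \<longleftrightarrow> (AE x in lebesgue. x \<in> S \<longrightarrow> P x)"
  by (simp add: AE_restrict_space_iff)

lemma AE_lebesgue_on_subset_Icc:
  fixes a b x y :: real
  assumes "AE r in lebesgue_on {a<..<b}. P r" "a \<le> x" "y \<le> b"
  shows "AE r in lebesgue_on {x..y}. P r"
proof -
  have "AE r in lebesgue. r \<in> {a<..<b} \<longrightarrow> P r" "AE r in lebesgue. r \<in> {a..b} \<longrightarrow> r \<in> {a<..<b}"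
    by (rule iffD1[OF AE_lebesgue_on_iff assms(1)], simp)
      (rule iffD1[OF AE_lebesgue_on_iff AE_lebesgue_on_Icc_Ioo], simp)
  then have "AE r in lebesgue. r \<in> {x..y} \<longrightarrow> P r"
    by eventually_elim (use assms(2,3) in auto)
  then show ?thesis by (subst AE_lebesgue_on_iff) simp
qed

lemma integrable_LINT_AE_eq:
  fixes f g :: "real \<Rightarrow> real"
  assumes "integrable (lebesgue_on S) f" "S \<in> sets lebesgue" "AE x in lebesgue_on S. f x = g x"
  shows "integrable (lebesgue_on S) g" "(LINT x|lebesgue_on S. g x) = (LINT x|lebesgue_on S. f x)"
proof -
  have m: "g \<in> borel_measurable (lebesgue_on S)"
    by (rule borel_measurable_lebesgue_on_AE[OF _ assms(2,3)]) (use assms in auto)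
  show "integrable (lebesgue_on S) g" by (rule integrable_cong_AE_imp[OF assms(1) m]) (use assms(3) in auto)
  show "(LINT x|lebesgue_on S. g x) = (LINT x|lebesgue_on S. f x)"
    by (rule integral_cong_AE) (use assms m in auto)
qed

lemma Linf_AE_bounded:
  assumes "b \<in> Linf S"
  obtains M where "AE r in lebesgue_on S. \<bar>b r\<bar> \<le> M"
proof -
  obtain M where M: "esssup (lebesgue_on S) (\<lambda>x. ereal \<bar>b x\<bar>) < ereal M"
    using assms ereal_dense2[of _ \<infinity>] by (auto simp: Linf_def)
  have "AE r in lebesgue_on S. ereal \<bar>b r\<bar> \<le> esssup (lebesgue_on S) (\<lambda>x. ereal \<bar>b x\<bar>)"
    by (rule esssup_AE)
  then have "AE r in lebesgue_on S. \<bar>b r\<bar> \<le> M"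
    by (rule eventually_mono) (metis M ereal_less_eq(3) less_imp_le order_trans)
  then show thesis by (rule that)
qed

text \<open>Density of the extended reals provides a real threshold strictly between
  \<open>C\<close> and the essential infimum.\<close>

lemma ess_inf_greater_AE:
  assumes "ereal C < ess_inf S f"
  obtains \<beta> where "C < \<beta>" "AE r in lebesgue_on S. \<beta> \<le> f r"
proof -
  obtain \<beta> where \<beta>: "ereal C < ereal \<beta>" "ereal \<beta> < ess_inf S f" using ereal_dense2[OF assms] by blast
  have "AE r in lebesgue_on S. - ereal (f r) \<le> esssup (lebesgue_on S) (\<lambda>x. - ereal (f x))"
    by (rule esssup_AE)
  then have "AE r in lebesgue_on S. \<beta> \<le> f r"
  proof (rule eventually_mono)
    fix r assume "- ereal (f r) \<le> esssup (lebesgue_on S) (\<lambda>x. - ereal (f x))"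
    then have "ess_inf S f \<le> ereal (f r)" unfolding ess_inf_def by (metis ereal_minus_le_minus ereal_uminus_uminus)
    then have "ereal \<beta> \<le> ereal (f r)" using \<beta>(2) by order
    then show "\<beta> \<le> f r" by simp
  qed
  with \<beta>(1) show thesis by (intro that) auto
qed

lemma integral_mono_AE_const:
  fixes f :: "real \<Rightarrow> real"
  assumes "f \<in> borel_measurable (lebesgue_on {x..y})" "\<And>r. r \<in> {x..y} \<Longrightarrow> \<bar>f r\<bar> \<le> M"
    and "AE r in lebesgue_on {x..y}. \<beta> \<le> f r" "x \<le> y"
  shows "\<beta> * (y - x) \<le> integral {x..y} f"
proof -
  have i: "integrable (lebesgue_on {x..y}) f" by (rule integrable_bounded_lebesgue_on[OF assms(1,2)])
  have c: "integrable (lebesgue_on {x..y}) (\<lambda>r. \<beta>)" by (intro integrable_continuous_lebesgue_on continuous_intros)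
  have "(LINT r|lebesgue_on {x..y}. \<beta>) \<le> (LINT r|lebesgue_on {x..y}. f r)"
    by (rule integral_mono_AE[OF c i assms(3)])
  from this[unfolded LINT_Icc_eq_integral[OF i] LINT_Icc_eq_integral[OF c]] show ?thesis
    using assms(4) by (simp add: mult.commute)
qed

text \<open>A bounded derivative makes \<open>(m - J)^2\<close> Lipschitz. As \<open>J - m\<close>
  is nonnegative, the square of an increment of \<open>m\<close> is at most the increment of this
  square in absolute value, and a square root gives exponent 1/2.\<close>

lemma holder_half_if_square_C1:
  assumes ab: "a < b" and m: "\<And>x. x \<in> {a..b} \<Longrightarrow> m x \<le> J" and mc: "continuous_on {a..b} m"
    and vc: "continuous_on {a..b} v'" and v: "\<And>x. x \<in> {a<..<b} \<Longrightarrow> ((\<lambda>r. (m r - J)\<^sup>2) has_real_derivative v' x) (at x)"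
  shows "holder_on (1/2) {a..b} m"
proof -
  obtain V where V: "\<And>x. x \<in> {a..b} \<Longrightarrow> \<bar>v' x\<bar> \<le> V"
    using compact_imp_bounded[OF compact_continuous_image[OF vc compact_Icc]]
    by (force simp: bounded_iff)
  have V0: "V \<ge> 0" using V[of a] ab by force
  define u where "u r = (m r - J)\<^sup>2" for r
  have uc: "continuous_on {a..b} u" unfolding u_def by (intro continuous_intros mc)
  have lt: "\<bar>u y - u x\<bar> \<le> V * (y - x)" if xy: "a \<le> x" "x < y" "y \<le> b" for x y
  proof -
    have "continuous_on {x..y} u" by (rule continuous_on_subset[OF uc]) (use xy in auto)
    moreover have "u differentiable (at z)" if "x < z" "z < y" for z
      using v[of z] that xy unfolding u_def[abs_def] by (auto simp: real_differentiable_def)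
    ultimately obtain e z where z: "x < z" "z < y" "(u has_real_derivative e) (at z)" "u y - u x = (y - x) * e"
      using MVT[OF xy(2)] by metis
    have "e = v' z" using DERIV_unique[OF z(3)] v[of z] z xy unfolding u_def[abs_def] by auto
    then have "\<bar>u y - u x\<bar> = \<bar>v' z\<bar> * (y - x)" using z xy by (simp add: abs_mult)
    also have "\<dots> \<le> V * (y - x)" using V[of z] z xy by (intro mult_right_mono) auto
    finally show ?thesis .
  qed
  have le: "\<bar>u x - u y\<bar> \<le> V * \<bar>x - y\<bar>" if "x \<in> {a..b}" "y \<in> {a..b}" for x y
    using lt[of x y] lt[of y x] that by (cases x y rule: linorder_cases) (auto simp: abs_minus_commute)
  have "\<bar>m x - m y\<bar> \<le> sqrt V * \<bar>x - y\<bar> powr (1/2)" if xy: "x \<in> {a..b}" "y \<in> {a..b}" for x y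
  proof -
    have "(m x - m y)\<^sup>2 \<le> \<bar>u x - u y\<bar>"
    proof -
      \<comment> \<open>For nonnegative numbers \<open>|s - t| \<le> s + t\<close>; multiply by
        \<open>|s - t|\<close>.\<close>
      have *: "(s - t)\<^sup>2 \<le> \<bar>s\<^sup>2 - t\<^sup>2\<bar>" if "s \<ge> 0" "t \<ge> 0" for s t :: real
      proof -
        have "\<bar>s - t\<bar> * \<bar>s - t\<bar> \<le> \<bar>s - t\<bar> * \<bar>s + t\<bar>" using that by (intro mult_left_mono) auto
        moreover have "s\<^sup>2 - t\<^sup>2 = (s - t) * (s + t)" by (simp add: power2_eq_square algebra_simps)
        ultimately show ?thesis by (simp add: abs_mult power2_eq_square abs_mult_self_eq)
      qed
      have "(m x - m y)\<^sup>2 = ((J - m x) - (J - m y))\<^sup>2" by (simp add: power2_commute)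
      also have "\<dots> \<le> \<bar>(J - m x)\<^sup>2 - (J - m y)\<^sup>2\<bar>" using m xy by (intro *) auto
      finally show ?thesis by (simp add: u_def power2_commute)
    qed
    then have "\<bar>m x - m y\<bar> \<le> sqrt (V * \<bar>x - y\<bar>)"
      using le[OF xy] by (intro real_le_rsqrt) simp
    then show ?thesis by (simp add: real_sqrt_mult powr_half_sqrt)
  qed
  then show ?thesis unfolding holder_on_def using V0 by (intro exI[of _ "sqrt V"]) auto
qed

text \<open>Both dimensions at once: the geometric source is a constant \<open>c\<close>, namely 0
  for \<open>n = 2\<close> and 2 for \<open>n = 3\<close>, and the last term of the lower bound is
  the derivative of \<open>r^(n-1) / \<tau>\<close>.\<close>

lemma interior_supersonic_solution_exists:
  fixes r0 r1 \<tau> J c \<beta> :: real and n :: nat and b B :: "real \<Rightarrow> real"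
  assumes r: "0 < r0" "r0 < r1" and \<tau>: "\<tau> > 0" and J: "J > 0" and n: "n \<ge> 2"
    and b: "b \<in> Linf {r0<..<r1}" and B: "B = (\<lambda>r. r ^ (n - 1) * b r)"
    and c: "\<And>r. r > 0 \<Longrightarrow> r powi (int n - 3) * (real n - 1) * (real n - 2) = c"
    and \<beta>: "J < \<beta>" "AE r in lebesgue_on {r0..r1}. \<beta> \<le> B r - c + real (n - 1) * r ^ (n - 2) / \<tau>"
  shows "\<exists>m. interior_supersonic_solution n r0 r1 \<tau> J B m \<and> holder_on (1/2) {r0..r1} m \<and>
                 (\<exists>l>0. \<forall>r\<in>{r0<..<r1}. l \<le> m r \<and> m r < J)"
proof -
  obtain Mb where Mb: "AE r in lebesgue_on {r0<..<r1}. \<bar>b r\<bar> \<le> Mb" using Linf_AE_bounded[OF b] by blast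
  define M where "M = r1 ^ (n - 1) * \<bar>Mb\<bar>"
  have M0: "M \<ge> 0" using r by (simp add: M_def)
  have BM: "AE r in lebesgue_on {r0<..<r1}. \<bar>B r\<bar> \<le> M"
    using Mb AE_space
  proof eventually_elim
    case (elim x)
    then show ?case using r unfolding B M_def abs_mult by (intro mult_mono) (auto intro!: power_mono)
  qed
  \<comment> \<open>\<open>B - c\<close>, clipped and extended by zero: bounded and measurable
    everywhere, while changed only on a null set within the interval.\<close>
  define d where "d x = (if x \<in> {r0<..<r1} then max (- M) (min M (B x)) - c else 0)" for x
  have d_AE: "AE x in lebesgue_on {r0<..<r1}. d x = B x - c"
    using BM AE_space by eventually_elim (auto simp: d_def)
  have "B \<in> borel_measurable (lebesgue_on {r0<..<r1})"
    unfolding B using b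
    by (intro borel_measurable_times) (auto simp: Linf_def intro!: continuous_imp_measurable_on_sets_lebesgue continuous_intros)
  then have "(\<lambda>x. max (- M) (min M (B x)) - c) \<in> borel_measurable (lebesgue_on {r0<..<r1})"
    by measurable
  then have "d \<in> borel_measurable lebesgue"
    unfolding d_def[abs_def] by (intro borel_measurable_if_I) auto
  then have dm: "d \<in> borel_measurable (lebesgue_on {x..y})" for x y
    by (rule measurable_restrict_space1)
  have db: "\<bar>d x\<bar> \<le> M + \<bar>c\<bar>" for x using M0 by (auto simp: d_def)
  have di: "d integrable_on {x..y}" for x y by (rule integrable_on_lebesgue_on_bounded[OF dm db])
  have strict: "J * (y - x) < integral {x..y} d + J / \<tau> / J * (y ^ (n - 1) - x ^ (n - 1))"
    if xy: "r0 \<le> x" "x < y" "y \<le> r1" for x y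
  proof -
    \<comment> \<open>The derivative of \<open>s^(n-1) / \<tau>\<close>. Integrating the almost
      everywhere lower bound for \<open>d + q\<close> yields the increment inequality.\<close>
    define q where "q s = real (n - 1) * s ^ (n - 2) / \<tau>" for s
    have qc: "continuous_on {x..y} q" unfolding q_def by (intro continuous_intros) (use \<tau> in auto)
    obtain Q where Q: "\<And>s. s \<in> {x..y} \<Longrightarrow> \<bar>q s\<bar> \<le> Q"
      using compact_imp_bounded[OF compact_continuous_image[OF qc compact_Icc]]
      by (force simp: bounded_iff)
    \<comment> \<open>Writing \<open>n = 2 + j\<close> resolves the truncated subtractions in the
      exponents.\<close>
    obtain j where j: "n = 2 + j" using n le_Suc_ex by blast
    have "((\<lambda>s. s ^ (n - 1) / \<tau>) has_real_derivative q s) (at s)" for s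
      using DERIV_cdivide[OF DERIV_pow[of "Suc j" s]] by (simp add: j q_def)
    then have "(q has_integral y ^ (n - 1) / \<tau> - x ^ (n - 1) / \<tau>) {x..y}"
      using xy by (intro fundamental_theorem_of_calculus)
        (auto simp: has_real_derivative_iff_has_vector_derivative intro: has_vector_derivative_at_within)
    then have qi: "q integrable_on {x..y}" "integral {x..y} q = (y ^ (n - 1) - x ^ (n - 1)) / \<tau>"
      by (auto simp: diff_divide_distrib dest: integral_unique)
    have "AE s in lebesgue_on {r0<..<r1}. \<beta> \<le> B s - c + q s"
      using \<beta>(2) unfolding q_def by (simp add: AE_restrict_space_iff) (erule eventually_mono, auto)
    then have "AE s in lebesgue_on {r0<..<r1}. \<beta> \<le> d s + q s"
      using d_AE by eventually_elim simp
    then have "AE s in lebesgue_on {x..y}. \<beta> \<le> d s + q s"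
      by (rule AE_lebesgue_on_subset_Icc) (use xy in auto)
    then have "\<beta> * (y - x) \<le> integral {x..y} (\<lambda>s. d s + q s)"
    proof (rule integral_mono_AE_const[rotated 2])
      show "(\<lambda>s. d s + q s) \<in> borel_measurable (lebesgue_on {x..y})"
        by (intro borel_measurable_add dm borel_measurable_continuous_lebesgue_on_Icc qc)
      show "\<bar>d s + q s\<bar> \<le> M + \<bar>c\<bar> + Q" if "s \<in> {x..y}" for s using db[of s] Q[OF that] by linarith
    qed (use xy in auto)
    also have "\<dots> = integral {x..y} d + (y ^ (n - 1) - x ^ (n - 1)) / \<tau>"
      using Henstock_Kurzweil_Integration.integral_add[OF di qi(1)] qi(2) by simp
    finally have "\<beta> * (y - x) \<le> integral {x..y} d + (y ^ (n - 1) - x ^ (n - 1)) / \<tau>" .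
    moreover have "J * (y - x) < \<beta> * (y - x)" using \<beta>(1) xy by simp
    ultimately show ?thesis using J by simp
  qed
  have lam: "J / \<tau> \<ge> 0" using J \<tau> by simp
  have pc: "continuous_on {r0..r1} (\<lambda>x. x ^ (n - 1))" by (intro continuous_intros)
  have p0: "0 < x ^ (n - 1)" if "x \<in> {r0..r1}" for x using that r by simp
  obtain m v' k l where mc: "continuous_on {r0..r1} m" and mJ: "m r0 = J" "m r1 = J" and l: "l > 0"
    and ml: "\<And>x. x \<in> {r0..r1} \<Longrightarrow> l \<le> m x" "\<And>x. x \<in> {r0..r1} \<Longrightarrow> m x \<le> J" "\<And>x. x \<in> {r0<..<r1} \<Longrightarrow> m x < J"
    and v'c: "continuous_on {r0..r1} v'"
    and v': "\<And>x. x \<in> {r0<..<r1} \<Longrightarrow> ((\<lambda>r. (m r - J)\<^sup>2) has_real_derivative v' x) (at x)"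
    and eq: "\<And>x. x \<in> {r0..r1} \<Longrightarrow> x ^ (n - 1) * ((m x + J) / (2 * m x ^ 3)) * v' x + x ^ (n - 1) * (J / \<tau>) / m x
       = k + integral {r0..x} (\<lambda>t. m t - d t)"
  proof (rule supersonic_profile_exists[of r0 r1 "J / \<tau>" J "\<lambda>x. x ^ (n - 1)" d, OF r(2) lam J pc])
    show "0 < x ^ (n - 1)" if "x \<in> {r0..r1}" for x by (rule p0[OF that])
    show "d integrable_on {r0..r1}" by (rule di)
    show "J * (y - x) < integral {x..y} d + J / \<tau> / J * (y ^ (n - 1) - x ^ (n - 1))"
      if "r0 \<le> x" "x < y" "y \<le> r1" for x y by (rule strict[OF that])
  qed (rule that)
  define v where "v x = (m x - J)\<^sup>2" for x
  have vc: "continuous_on {r0..r1} v" unfolding v_def by (intro continuous_intros mc)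
  have vD: "(v has_real_derivative v' x) (at x)" if "x \<in> {r0<..<r1}" for x
    using v'[OF that] by (simp add: v_def[abs_def])
  have vH: "v \<in> H10 r0 r1" by (rule H10_C1[OF r(2) vc v'c vD]) (simp_all add: v_def mJ)
  have wv: "AE x in lebesgue_on {r0<..<r1}. weak_deriv r0 r1 v x = v' x"
    by (rule weak_deriv_AE_eq[OF r(2)]) (rule has_weak_deriv_C1[OF r(2) vc v'c vD])
  define \<Phi> where "\<Phi> x = x ^ (n - 1) * ((m x + J) / (2 * m x ^ 3)) * v' x + x ^ (n - 1) * J / (\<tau> * m x)" for x
  define g where "g x = m x - d x" for x
  have \<Phi>: "\<Phi> x = k + integral {r0..x} g" if "x \<in> {r0..r1}" for x
    using eq[OF that] by (simp add: \<Phi>_def g_def[abs_def])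
  have gm: "g \<in> borel_measurable (lebesgue_on {r0..r1})"
    unfolding g_def[abs_def] by (intro borel_measurable_diff dm borel_measurable_continuous_lebesgue_on_Icc mc)
  have gb: "\<bar>g x\<bar> \<le> J + (M + \<bar>c\<bar>)" if "x \<in> {r0..r1}" for x
    using ml(1,2)[OF that] l db[of x] unfolding g_def by linarith
  let ?flux = "\<lambda>\<phi> x. (x ^ (n - 1) * ((m x + J) / (2 * m x ^ 3)) * weak_deriv r0 r1 v x
        + x ^ (n - 1) * J / (\<tau> * m x)) * weak_deriv r0 r1 \<phi> x"
  let ?source = "\<lambda>\<phi> x. (m x - B x + x powi (int n - 3) * (real n - 1) * (real n - 2)) * \<phi> x"
  have weak: "integrable (lebesgue_on {r0<..<r1}) (?flux \<phi>) \<and> integrable (lebesgue_on {r0<..<r1}) (?source \<phi>)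
    \<and> (LINT x|lebesgue_on {r0<..<r1}. ?flux \<phi> x) + (LINT x|lebesgue_on {r0<..<r1}. ?source \<phi> x) = 0"
    if "\<phi> \<in> H10 r0 r1" for \<phi>
  proof -
    note we = weak_equation_H10[OF r(2) that gm gb \<Phi>]
    \<comment> \<open>The integrated equation holds for the representatives \<open>v'\<close> and
      \<open>d\<close>; the definition speaks of \<open>weak_deriv\<close> and \<open>B\<close>,
      which agree with them up to null sets and the constant \<open>c\<close>.\<close>
    have a1: "AE x in lebesgue_on {r0<..<r1}. \<Phi> x * weak_deriv r0 r1 \<phi> x = ?flux \<phi> x"
      using wv by eventually_elim (simp add: \<Phi>_def)
    have a2: "AE x in lebesgue_on {r0<..<r1}. g x * \<phi> x = ?source \<phi> x"
      using d_AE AE_space by eventually_elim (use r c in \<open>auto simp: g_def\<close>)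
    show ?thesis
      using integrable_LINT_AE_eq[OF we(1) _ a1] integrable_LINT_AE_eq[OF we(2) _ a2] we(3) by simp
  qed
  have "interior_supersonic_solution n r0 r1 \<tau> J B m"
    unfolding interior_supersonic_solution_def Let_def
  proof (intro conjI ballI)
    show "m r0 = J" "m r1 = J" by (fact mJ)+
    show "0 < m x" "m x < J" if "x \<in> {r0<..<r1}" for x using ml(1)[of x] ml(3)[OF that] l that by auto
    show "(\<lambda>r. (m r - J)\<^sup>2) \<in> H10 r0 r1" using vH by (simp only: v_def[abs_def])
  qed (use weak in \<open>simp_all only: v_def[abs_def]\<close>)
  moreover have "holder_on (1/2) {r0..r1} m"
    by (rule holder_half_if_square_C1[OF r(2) ml(2) mc v'c v'])
  moreover have "\<exists>l>0. \<forall>r\<in>{r0<..<r1}. l \<le> m r \<and> m r < J"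
    using l ml by (intro exI[of _ l]) auto
  ultimately show ?thesis by blast
qed

theorem theorem1p5:
  fixes r0 r1 \<tau> J :: real and n :: nat and b B :: "real \<Rightarrow> real"
  assumes "0 < r0" and "r0 < r1" and "\<tau> > 0" and "J > 0" and "n \<in> {2, 3}"
    and "b \<in> Linf {r0<..<r1}"
    and "AE r in lebesgue_on {r0<..<r1}. b r > 0"
    and "B = (\<lambda>r. r ^ (n - 1) * b r)"
  shows "(n = 2 \<longrightarrow> ess_inf {r0..r1} B + ereal (1 / \<tau>) > ereal J \<longrightarrow>
            (\<exists>m. interior_supersonic_solution n r0 r1 \<tau> J B m \<and> holder_on (1/2) {r0..r1} m \<and>
                 (\<exists>l>0. \<forall>r\<in>{r0<..<r1}. l \<le> m r \<and> m r < J))) \<and>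
         (n = 3 \<longrightarrow> ess_inf {r0..r1} (\<lambda>r. B r + 2 * r / \<tau> - 2) > ereal J \<longrightarrow>
            (\<exists>m. interior_supersonic_solution n r0 r1 \<tau> J B m \<and> holder_on (1/2) {r0..r1} m \<and>
                 (\<exists>l>0. \<forall>r\<in>{r0<..<r1}. l \<le> m r \<and> m r < J)))"
proof (intro conjI impI)
  assume n: "n = 2" and h: "ess_inf {r0..r1} B + ereal (1 / \<tau>) > ereal J"
  have "ereal (J - 1 / \<tau>) < ess_inf {r0..r1} B"
    using h by (cases "ess_inf {r0..r1} B") auto
  then obtain \<beta> where \<beta>: "J - 1 / \<tau> < \<beta>" "AE r in lebesgue_on {r0..r1}. \<beta> \<le> B r"
    by (rule ess_inf_greater_AE)
  show "\<exists>m. interior_supersonic_solution n r0 r1 \<tau> J B m \<and> holder_on (1/2) {r0..r1} m \<and>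
                 (\<exists>l>0. \<forall>r\<in>{r0<..<r1}. l \<le> m r \<and> m r < J)"
  \<comment> \<open>In dimension two the derivative of \<open>r / \<tau>\<close> is the constant
    \<open>1 / \<tau>\<close>, which shifts the threshold for \<open>B\<close>.\<close>
  proof (rule interior_supersonic_solution_exists[where c=0 and \<beta>="\<beta> + 1 / \<tau>"])
    show "AE r in lebesgue_on {r0..r1}. \<beta> + 1 / \<tau> \<le> B r - 0 + real (n - 1) * r ^ (n - 2) / \<tau>"
      using \<beta>(2) by eventually_elim (simp add: n)
  qed (use assms n \<beta> in auto)
next
  assume n: "n = 3" and h: "ess_inf {r0..r1} (\<lambda>r. B r + 2 * r / \<tau> - 2) > ereal J"
  obtain \<beta> where \<beta>: "J < \<beta>" "AE r in lebesgue_on {r0..r1}. \<beta> \<le> B r + 2 * r / \<tau> - 2"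
    using h by (rule ess_inf_greater_AE)
  show "\<exists>m. interior_supersonic_solution n r0 r1 \<tau> J B m \<and> holder_on (1/2) {r0..r1} m \<and>
                 (\<exists>l>0. \<forall>r\<in>{r0<..<r1}. l \<le> m r \<and> m r < J)"
  proof (rule interior_supersonic_solution_exists[where c=2 and \<beta>=\<beta>])
    show "AE r in lebesgue_on {r0..r1}. \<beta> \<le> B r - 2 + real (n - 1) * r ^ (n - 2) / \<tau>"
      using \<beta>(2) by eventually_elim (simp add: n)
  qed (use assms n \<beta> in auto)
qed

end
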